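(* The contravariant functors $\mathrm{at}$ and $\mathcal{P}$, which yield a dual equivalence between the category $\mathbf{LCHMT}$ of locally compact Hausdorff MT-algebras with proper MT-morphisms and the category $\mathbf{LCHaus}$ of locally compact Hausdorff spaces with proper maps, restrict to a dual equivalence between the full subcategory $\mathbf{LStoneMT}$ of $\mathbf{LCHMT}$ consisting of locally Stone MT-algebras and the full subcategory $\mathbf{LStone}$ of $\mathbf{LCHaus}$ consisting of locally Stone spaces.
   Context: An MT-algebra is a pair $M=(B,\square)$ where $B$ is a complete boolean algebra and $\square:B\to B$ satisfies $\square 1=1$, $\square(a\wedge b)=\square a\wedge\square b$, $\square a\le a$, $\square a\le\square\square a$. An MT-morphism $f:M\to N$ is a complete boolean homomorphism with $f(\square_M a)\le\square_N f(a)$ for all $a$. Put $\diamond a=\neg\square\neg a$. An element $a$ is open if $a=\square a$, closed if $a=\diamond a$, clopen if both; $\mathrm{O}(M)$ is the set of open elements and $\mathrm{clp}(M)$ the set of clopen elements. An element is saturated if it is a meet of open elements. $M$ is a $T_1$-algebra if every element is a join of closed elements. $M$ is Hausdorff if every element of $M$ is a join of elements of $\mathrm{AC}(M)=\{a\in M\mid a=\bigwedge\{\diamond\square c\mid c\in M,\ a\le\square c\}\}$. $M$ is zero-dimensional if it is a $T_1$-algebra and $a=\bigvee\{b\in\mathrm{clp}(M)\mid b\le a\}$ for every $a\in\mathrm{O}(M)$. An element $a$ is compact if for each $S\subseteq\mathrm{O}(M)$ with $a\le\bigvee S$ there is a finite $T\subseteq S$ with $a\le\bigvee T$; $\mathrm{KS}(M)$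 is the set of compact saturated elements. For $a,b\in M$ write $a\vartriangleleft b$ if there is a compact $k$ with $a\le k\le b$. $M$ is locally compact if $u=\bigvee\{v\in\mathrm{O}(M)\mid v\vartriangleleft u\}$ for all $u\in\mathrm{O}(M)$. $M$ is locally Stone if it is zero-dimensional, locally compact, and Hausdorff. An MT-morphism $f:M\to N$ is proper if $a\in\mathrm{KS}(M)$ implies $f(a)\in\mathrm{KS}(N)$. A space is zero-dimensional if it is $T_1$ and its clopen sets form a basis; it is locally Stone if it is zero-dimensional, locally compact, and Hausdorff. A continuous map $f:X\to Y$ is proper if $f^{-1}(K)$ is compact for each compact saturated $K\subseteq Y$ (saturated = intersection of open sets). Functors: $\mathcal{P}$ sends a space $X$ to $(\mathcal{P}(X),\mathrm{int})$ (the powerset with the interior operator) and a map $f$ to $f^{-1}$. $\mathrm{at}$ sends $M$ to its set of atoms $\mathrm{at}(M)$ with topology $\{\eta(a)\mid a\in\mathrm{O}(M)\}$, where $\eta(a)=\{x\in\mathrm{at}(M)\mid x\le a\}$, and an MT-morphism $f:M\to N$ to $\mathrm{at}(f):\mathrm{at}(N)\to\mathrm{at}(M)$, the restriction to atoms of the left adjoint $f^*(x)=\bigwedge\{a\in M\mid x\le f(a)\}$. *)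

theory Defs
  imports "HOL-Analysis.Analysis" "HOL-Algebra.Complete_Lattice"
begin

section \<open>MT-algebras\<close>

text \<open>
  MT-algebras are carrier-based: the powerset algebra of a space \<open>X\<close> has carrier
  \<open>Pow (topspace X)\<close>, which in general is not a whole type.  Suprema and infima of the
  empty family are the bottom and the top, so \<open>complete_lattice\<close> includes the bounds; the
  one-element algebra is allowed.
\<close>

locale complete_boolean_lattice = Complete_Lattice.complete_lattice L for L (structure) +
  assumes distrib: "\<lbrakk>x \<in> carrier L; y \<in> carrier L; z \<in> carrier L\<rbrakk>
      \<Longrightarrow> x \<sqinter> (y \<squnion> z) = (x \<sqinter> y) \<squnion> (x \<sqinter> z)"
    and complemented: "x \<in> carrier L \<Longrightarrow> \<exists>y\<in>carrier L. x \<sqinter> y = \<bottom> \<and> x \<squnion> y = \<top>"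

definition compl :: "('a, 'm) gorder_scheme \<Rightarrow> 'a \<Rightarrow> 'a" where
  "compl L a = (THE b. b \<in> carrier L \<and> a \<sqinter>\<^bsub>L\<^esub> b = \<bottom>\<^bsub>L\<^esub> \<and> a \<squnion>\<^bsub>L\<^esub> b = \<top>\<^bsub>L\<^esub>)"

record 'a mt = "'a gorder" +
  mt_box :: "'a \<Rightarrow> 'a"

locale mt_algebra = complete_boolean_lattice M for M :: "'a mt" (structure) +
  assumes box_closed: "a \<in> carrier M \<Longrightarrow> mt_box M a \<in> carrier M"
    and box_top: "mt_box M \<top> = \<top>"
    and box_meet: "\<lbrakk>a \<in> carrier M; b \<in> carrier M\<rbrakk>
      \<Longrightarrow> mt_box M (a \<sqinter> b) = mt_box M a \<sqinter> mt_box M b"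
    and box_le: "a \<in> carrier M \<Longrightarrow> mt_box M a \<sqsubseteq> a"
    and box_idem: "a \<in> carrier M \<Longrightarrow> mt_box M a \<sqsubseteq> mt_box M (mt_box M a)"

definition mt_dia :: "'a mt \<Rightarrow> 'a \<Rightarrow> 'a" where
  "mt_dia M a = compl M (mt_box M (compl M a))"

definition mt_opens :: "'a mt \<Rightarrow> 'a set" where
  "mt_opens M = {a \<in> carrier M. a = mt_box M a}"

definition mt_closeds :: "'a mt \<Rightarrow> 'a set" where
  "mt_closeds M = {a \<in> carrier M. a = mt_dia M a}"

definition mt_clopens :: "'a mt \<Rightarrow> 'a set" where
  "mt_clopens M = mt_opens M \<inter> mt_closeds M"

definition mt_saturated :: "'a mt \<Rightarrow> 'a \<Rightarrow> bool" where
  "mt_saturated M a \<longleftrightarrow> (\<exists>S\<subseteq>mt_opens M. a = \<Sqinter>\<^bsub>M\<^esub> S)"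

definition mt_t1 :: "'a mt \<Rightarrow> bool" where
  "mt_t1 M \<longleftrightarrow> (\<forall>a\<in>carrier M. \<exists>S\<subseteq>mt_closeds M. a = \<Squnion>\<^bsub>M\<^esub> S)"

definition mt_AC :: "'a mt \<Rightarrow> 'a set" where
  "mt_AC M = {a \<in> carrier M.
     a = \<Sqinter>\<^bsub>M\<^esub> {mt_dia M (mt_box M c) | c. c \<in> carrier M \<and> a \<sqsubseteq>\<^bsub>M\<^esub> mt_box M c}}"

definition mt_hausdorff :: "'a mt \<Rightarrow> bool" where
  "mt_hausdorff M \<longleftrightarrow> (\<forall>a\<in>carrier M. \<exists>S\<subseteq>mt_AC M. a = \<Squnion>\<^bsub>M\<^esub> S)"

definition mt_zero_dimensional :: "'a mt \<Rightarrow> bool" where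
  "mt_zero_dimensional M \<longleftrightarrow>
     mt_t1 M \<and> (\<forall>a\<in>mt_opens M. a = \<Squnion>\<^bsub>M\<^esub> {b \<in> mt_clopens M. b \<sqsubseteq>\<^bsub>M\<^esub> a})"

definition mt_compact :: "'a mt \<Rightarrow> 'a \<Rightarrow> bool" where
  "mt_compact M a \<longleftrightarrow> a \<in> carrier M \<and>
     (\<forall>S\<subseteq>mt_opens M. a \<sqsubseteq>\<^bsub>M\<^esub> \<Squnion>\<^bsub>M\<^esub> S \<longrightarrow> (\<exists>T\<subseteq>S. finite T \<and> a \<sqsubseteq>\<^bsub>M\<^esub> \<Squnion>\<^bsub>M\<^esub> T))"

definition mt_KS :: "'a mt \<Rightarrow> 'a set" where
  "mt_KS M = {a. mt_compact M a \<and> mt_saturated M a}"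

definition mt_way_below :: "'a mt \<Rightarrow> 'a \<Rightarrow> 'a \<Rightarrow> bool" where
  "mt_way_below M a b \<longleftrightarrow> (\<exists>k. mt_compact M k \<and> a \<sqsubseteq>\<^bsub>M\<^esub> k \<and> k \<sqsubseteq>\<^bsub>M\<^esub> b)"

definition mt_locally_compact :: "'a mt \<Rightarrow> bool" where
  "mt_locally_compact M \<longleftrightarrow>
     (\<forall>u\<in>mt_opens M. u = \<Squnion>\<^bsub>M\<^esub> {v \<in> mt_opens M. mt_way_below M v u})"

definition mt_locally_stone :: "'a mt \<Rightarrow> bool" where
  "mt_locally_stone M \<longleftrightarrow> mt_zero_dimensional M \<and> mt_locally_compact M \<and> mt_hausdorff M"

text \<open>
  Morphisms are extensional functions on the carrier, so that equality of morphisms is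
  equality of functions.
\<close>

definition mt_hom :: "'a mt \<Rightarrow> 'b mt \<Rightarrow> ('a \<Rightarrow> 'b) set" where
  "mt_hom M N = {f \<in> carrier M \<rightarrow>\<^sub>E carrier N.
     sup_pres M N f \<and> inf_pres M N f \<and>
     (\<forall>a\<in>carrier M. f (compl M a) = compl N (f a)) \<and>
     (\<forall>a\<in>carrier M. f (mt_box M a) \<sqsubseteq>\<^bsub>N\<^esub> mt_box N (f a))}"

definition proper_mt_hom :: "'a mt \<Rightarrow> 'b mt \<Rightarrow> ('a \<Rightarrow> 'b) set" where
  "proper_mt_hom M N = {f \<in> mt_hom M N. \<forall>a\<in>mt_KS M. f a \<in> mt_KS N}"


section \<open>Spaces\<close>

definition saturated_in :: "'a topology \<Rightarrow> 'a set \<Rightarrow> bool" where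
  "saturated_in X K \<longleftrightarrow> (\<exists>\<U>. (\<forall>U\<in>\<U>. openin X U) \<and> K = topspace X \<inter> \<Inter>\<U>)"

definition zero_dimensional_space :: "'a topology \<Rightarrow> bool" where
  "zero_dimensional_space X \<longleftrightarrow>
     t1_space X \<and> openin X = arbitrary union_of (\<lambda>U. openin X U \<and> closedin X U)"

definition locally_stone_space :: "'a topology \<Rightarrow> bool" where
  "locally_stone_space X \<longleftrightarrow>
     zero_dimensional_space X \<and> locally_compact_space X \<and> Hausdorff_space X"

text \<open>This is not the library's \<open>proper_map\<close> (closed with compact fibres).\<close>

definition proper_cont_hom :: "'a topology \<Rightarrow> 'b topology \<Rightarrow> ('a \<Rightarrow> 'b) set" where
  "proper_cont_hom X Y = {f \<in> topspace X \<rightarrow>\<^sub>E topspace Y.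
     continuous_map X Y f \<and>
     (\<forall>K. compactin Y K \<and> saturated_in Y K \<longrightarrow> compactin X {x \<in> topspace X. f x \<in> K})}"


section \<open>Concrete categories and contravariant functors\<close>

text \<open>
  Both categories are concrete: each object has an underlying set, morphisms are extensional
  functions between underlying sets, and composition is composition of functions.  The
  associativity and unit laws hold automatically.
\<close>

record ('o, 'e) concrete_cat =
  Obj :: "'o set"
  Und :: "'o \<Rightarrow> 'e set"
  Hom :: "'o \<Rightarrow> 'o \<Rightarrow> ('e \<Rightarrow> 'e) set"

definition ident :: "'e set \<Rightarrow> 'e \<Rightarrow> 'e" where
  "ident A = (\<lambda>x\<in>A. x)"

definition concrete_category :: "('o, 'e) concrete_cat \<Rightarrow> bool" where
  "concrete_category C \<longleftrightarrow>
     (\<forall>A\<in>Obj C. \<forall>B\<in>Obj C. Hom C A B \<subseteq> Und C A \<rightarrow>\<^sub>E Und C B) \<and>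
     (\<forall>A\<in>Obj C. ident (Und C A) \<in> Hom C A A) \<and>
     (\<forall>A\<in>Obj C. \<forall>B\<in>Obj C. \<forall>D\<in>Obj C. \<forall>f\<in>Hom C A B. \<forall>g\<in>Hom C B D.
        compose (Und C A) g f \<in> Hom C A D)"

definition full_subcategory :: "('o, 'e) concrete_cat \<Rightarrow> ('o, 'e) concrete_cat \<Rightarrow> bool" where
  "full_subcategory S C \<longleftrightarrow> concrete_category S \<and> concrete_category C \<and> Obj S \<subseteq> Obj C \<and>
     (\<forall>A\<in>Obj S. Und S A = Und C A) \<and>
     (\<forall>A\<in>Obj S. \<forall>B\<in>Obj S. Hom S A B = Hom C A B)"

text \<open>The arrow part takes domain and codomain, since a function does not determine them.\<close>

definition contravariant_functor ::
  "('o, 'e) concrete_cat \<Rightarrow> ('p, 'd) concrete_cat \<Rightarrow>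
   ('o \<Rightarrow> 'p) \<Rightarrow> ('o \<Rightarrow> 'o \<Rightarrow> ('e \<Rightarrow> 'e) \<Rightarrow> ('d \<Rightarrow> 'd)) \<Rightarrow> bool" where
  "contravariant_functor C D Fo Fa \<longleftrightarrow> concrete_category C \<and> concrete_category D \<and>
     (\<forall>A\<in>Obj C. Fo A \<in> Obj D) \<and>
     (\<forall>A\<in>Obj C. \<forall>B\<in>Obj C. \<forall>f\<in>Hom C A B. Fa A B f \<in> Hom D (Fo B) (Fo A)) \<and>
     (\<forall>A\<in>Obj C. Fa A A (ident (Und C A)) = ident (Und D (Fo A))) \<and>
     (\<forall>A\<in>Obj C. \<forall>B\<in>Obj C. \<forall>E\<in>Obj C. \<forall>f\<in>Hom C A B. \<forall>g\<in>Hom C B E.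
        Fa A E (compose (Und C A) g f) = compose (Und D (Fo E)) (Fa A B f) (Fa B E g))"

definition LCHMT :: "('a mt, 'a) concrete_cat" where
  "LCHMT = \<lparr>Obj = {M. mt_algebra M \<and> mt_locally_compact M \<and> mt_hausdorff M},
            Und = carrier, Hom = proper_mt_hom\<rparr>"

definition LStoneMT :: "('a mt, 'a) concrete_cat" where
  "LStoneMT = \<lparr>Obj = {M. mt_algebra M \<and> mt_locally_stone M},
               Und = carrier, Hom = proper_mt_hom\<rparr>"

definition LCHaus :: "('a topology, 'a) concrete_cat" where
  "LCHaus = \<lparr>Obj = {X. locally_compact_space X \<and> Hausdorff_space X},
             Und = topspace, Hom = proper_cont_hom\<rparr>"

definition LStone :: "('a topology, 'a) concrete_cat" where
  "LStone = \<lparr>Obj = {X. locally_stone_space X},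
             Und = topspace, Hom = proper_cont_hom\<rparr>"


section \<open>The functors\<close>

definition mt_atoms :: "'a mt \<Rightarrow> 'a set" where
  "mt_atoms M = {x \<in> carrier M. x \<noteq> \<bottom>\<^bsub>M\<^esub> \<and>
     (\<forall>y\<in>carrier M. y \<sqsubseteq>\<^bsub>M\<^esub> x \<longrightarrow> y = \<bottom>\<^bsub>M\<^esub> \<or> y = x)}"

definition mt_eta :: "'a mt \<Rightarrow> 'a \<Rightarrow> 'a set" where
  "mt_eta M a = {x \<in> mt_atoms M. x \<sqsubseteq>\<^bsub>M\<^esub> a}"

definition at_space :: "'a mt \<Rightarrow> 'a topology" where
  "at_space M = topology (\<lambda>U. \<exists>a\<in>mt_opens M. U = mt_eta M a)"

definition left_adj :: "'a mt \<Rightarrow> 'b mt \<Rightarrow> ('a \<Rightarrow> 'b) \<Rightarrow> 'b \<Rightarrow> 'a" where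
  "left_adj M N f x = \<Sqinter>\<^bsub>M\<^esub> {a \<in> carrier M. x \<sqsubseteq>\<^bsub>N\<^esub> f a}"

definition at_map :: "'a mt \<Rightarrow> 'b mt \<Rightarrow> ('a \<Rightarrow> 'b) \<Rightarrow> ('b \<Rightarrow> 'a)" where
  "at_map M N f = restrict (left_adj M N f) (mt_atoms N)"

definition pow_mt :: "'a topology \<Rightarrow> 'a set mt" where
  "pow_mt X = \<lparr>carrier = Pow (topspace X), eq = (=), le = (\<subseteq>), mt_box = (\<lambda>A. X interior_of A)\<rparr>"

definition pow_map :: "'a topology \<Rightarrow> 'b topology \<Rightarrow> ('a \<Rightarrow> 'b) \<Rightarrow> ('b set \<Rightarrow> 'a set)" where
  "pow_map X Y f = (\<lambda>B\<in>Pow (topspace Y). {x \<in> topspace X. f x \<in> B})"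


section \<open>Dual equivalence\<close>

text \<open>
  In HOL the powerset functor raises the type: it sends spaces over \<open>'a\<close> to algebras over
  \<open>'a set\<close>.  The category of all (small) algebras is therefore rendered as the family of
  categories indexed by the type of the elements, and likewise for spaces.  The two natural
  isomorphisms, from the identity functor to the composites, have components between an object
  over \<open>'a\<close> and one over \<open>'a set\<close>, which is why isomorphisms are defined across types.
\<close>

definition proper_mt_iso :: "'a mt \<Rightarrow> 'b mt \<Rightarrow> ('a \<Rightarrow> 'b) \<Rightarrow> bool" where
  "proper_mt_iso M N f \<longleftrightarrow> f \<in> proper_mt_hom M N \<and>
     (\<exists>g\<in>proper_mt_hom N M. compose (carrier M) g f = ident (carrier M) \<and>
                            compose (carrier N) f g = ident (carrier N))"

definition proper_cont_iso :: "'a topology \<Rightarrow> 'b topology \<Rightarrow> ('a \<Rightarrow> 'b) \<Rightarrow> bool" where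
  "proper_cont_iso X Y f \<longleftrightarrow> f \<in> proper_cont_hom X Y \<and>
     (\<exists>g\<in>proper_cont_hom Y X. compose (topspace X) g f = ident (topspace X) \<and>
                              compose (topspace Y) f g = ident (topspace Y))"

text \<open>
  \<open>\<alpha>\<close> is a natural isomorphism from the identity of \<open>C\<close> to the functor with object part \<open>To\<close>
  and arrow part \<open>Ta\<close>, where \<open>is_iso\<close> is the notion of isomorphism.
\<close>

definition natural_iso_from_id ::
  "('o, 'e) concrete_cat \<Rightarrow> ('o \<Rightarrow> 'p \<Rightarrow> ('e \<Rightarrow> 'd) \<Rightarrow> bool) \<Rightarrow>
   ('o \<Rightarrow> 'p) \<Rightarrow> ('o \<Rightarrow> 'o \<Rightarrow> ('e \<Rightarrow> 'e) \<Rightarrow> ('d \<Rightarrow> 'd)) \<Rightarrow> ('o \<Rightarrow> 'e \<Rightarrow> 'd) \<Rightarrow> bool" where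
  "natural_iso_from_id C is_iso To Ta \<alpha> \<longleftrightarrow>
     (\<forall>A\<in>Obj C. is_iso A (To A) (\<alpha> A)) \<and>
     (\<forall>A\<in>Obj C. \<forall>B\<in>Obj C. \<forall>f\<in>Hom C A B.
        compose (Und C A) (Ta A B f) (\<alpha> A) = compose (Und C A) (\<alpha> B) f)"

text \<open>
  \<open>C\<close> and \<open>D\<close> are categories of MT-algebras and of spaces over \<open>'a\<close>, and \<open>C'\<close> and \<open>D'\<close> the same
  categories over \<open>'a set\<close>.
\<close>

definition at_pow_dual_equivalence ::
  "('a mt, 'a) concrete_cat \<Rightarrow> ('a topology, 'a) concrete_cat \<Rightarrow>
   ('a set mt, 'a set) concrete_cat \<Rightarrow> ('a set topology, 'a set) concrete_cat \<Rightarrow> bool" where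
  "at_pow_dual_equivalence C D C' D' \<longleftrightarrow>
     contravariant_functor C D at_space at_map \<and>
     contravariant_functor D C' pow_mt pow_map \<and>
     contravariant_functor C' D' at_space at_map \<and>
     natural_iso_from_id C proper_mt_iso
       (\<lambda>M. pow_mt (at_space M))
       (\<lambda>M N f. pow_map (at_space N) (at_space M) (at_map M N f))
       (\<lambda>M. \<lambda>a\<in>carrier M. mt_eta M a) \<and>
     natural_iso_from_id D proper_cont_iso
       (\<lambda>X. at_space (pow_mt X))
       (\<lambda>X Y f. at_map (pow_mt Y) (pow_mt X) (pow_map X Y f))
       (\<lambda>X. \<lambda>x\<in>topspace X. {x})"

end

theory Submission
  imports Defs
begin

text \<open>
  A \<open>T\<^sub>1\<close> locally compact MT-algebra is atomic, hence \<open>\<eta>\<close> identifies it with the powerset algebra of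
  its space of atoms, and compactness, saturation, interior and clopenness are read off through \<open>\<eta>\<close>.
  On atoms the left adjoint is characterised by \<open>f\<^sup>*(x) \<le> a \<longleftrightarrow> x \<le> f(a)\<close>; this yields functoriality,
  naturality and the preimage formula \<open>at(f)\<^sup>-\<^sup>1(\<eta>(a)) = \<eta>(f(a))\<close>, from which continuity and
  properness of \<open>at(f)\<close> follow.  Both dual equivalences are instances of one statement about classes
  of atomic algebras and of spaces that \<open>at\<close> and \<open>\<P>\<close> map to each other.
\<close>

section \<open>Complete boolean lattices\<close>

text \<open>A complete boolean algebra may have no atoms at all, so the points must come from the
  topology. \<open>T\<^sub>1\<close> puts a nonzero closed element below every nonzero element, and
  local compactness lets it be taken below a compact one, where shrinking closed elements cannot
  vanish. The Hausdorff condition gives \<open>T\<^sub>1\<close> because the elements of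
  \<open>mt_AC M\<close> are meets of closed elements. Two facts then carry every transfer. Atoms
  are completely join-prime, so \<open>mt_eta M\<close> respects all joins, meets and complements
  and reaches every set of atoms. Atomicity makes \<open>mt_eta M\<close> reflect the order, hence
  injective. Restricting to locally Stone objects therefore costs one additional transfer in each
  direction, that of zero-dimensionality. Since \<open>pow_mt\<close> raises the element type, each
  class of objects occurs at two types, and the unit and counit are isomorphisms between objects
  over different types.\<close>

context complete_boolean_lattice
begin

text \<open>Meeting \<open>y\<close> with the cover \<open>x \<squnion> z\<close> leaves only
  \<open>y \<sqinter> z\<close>. Distributivity is used through this lemma; uniqueness of
  complements and the order calculus of \<open>compl\<close> rest on it.\<close>

lemma le_of_disjoint_of_cover:
  assumes "x \<in> carrier L" "y \<in> carrier L" "z \<in> carrier L" "x \<sqinter> y = \<bottom>" "x \<squnion> z = \<top>"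
  shows "y \<sqsubseteq> z"
proof -
  have "y = y \<sqinter> (x \<squnion> z)"
    using assms top_higher le_iff_join[of y "\<top>"] by simp
  also have "\<dots> = (y \<sqinter> x) \<squnion> (y \<sqinter> z)"
    using assms by (intro distrib)
  also have "\<dots> = y \<sqinter> z"
    using assms by (metis bottom_join eq_is_equal meet_closed meet_comm)
  finally show ?thesis using assms le_iff_join by metis
qed

text \<open>Two complements of \<open>a\<close> are each below the other by the preceding lemma.
  This makes the description operator in \<open>compl\<close> meaningful.\<close>

lemma compl_ex1:
  assumes "a \<in> carrier L"
  shows "\<exists>!b. b \<in> carrier L \<and> a \<sqinter> b = \<bottom> \<and> a \<squnion> b = \<top>"
  using complemented[OF assms] le_of_disjoint_of_cover[OF assms] le_antisym by metis

lemma compl_closed [simp]: "a \<in> carrier L \<Longrightarrow> compl L a \<in> carrier L"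
  and meet_compl [simp]: "a \<in> carrier L \<Longrightarrow> a \<sqinter> compl L a = \<bottom>"
  and join_compl [simp]: "a \<in> carrier L \<Longrightarrow> a \<squnion> compl L a = \<top>"
  using theI'[OF compl_ex1[of a]] unfolding compl_def by auto

lemma compl_eqI:
  assumes "a \<in> carrier L" "b \<in> carrier L" "a \<sqinter> b = \<bottom>" "a \<squnion> b = \<top>"
  shows "compl L a = b"
  using compl_ex1[OF assms(1)] assms compl_closed meet_compl join_compl by metis

lemma compl_compl [simp]: "a \<in> carrier L \<Longrightarrow> compl L (compl L a) = a"
  by (rule compl_eqI) (simp_all add: meet_comm join_comm)

lemma disjoint_mono:
  assumes "a \<in> carrier L" "b \<in> carrier L" "c \<in> carrier L" "a \<sqsubseteq> b" "b \<sqinter> c = \<bottom>"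
  shows "a \<sqinter> c = \<bottom>"
proof -
  have "a \<sqinter> c \<sqsubseteq> b \<sqinter> c"
    using assms by (meson meet_closed meet_le meet_left meet_right le_trans)
  then show ?thesis using assms by (metis bottom_lower le_antisym bottom_closed meet_closed)
qed

lemma le_compl_iff:
  assumes "a \<in> carrier L" "b \<in> carrier L"
  shows "b \<sqsubseteq> compl L a \<longleftrightarrow> a \<sqinter> b = \<bottom>"
proof
  show "a \<sqinter> b = \<bottom> \<Longrightarrow> b \<sqsubseteq> compl L a"
    using le_of_disjoint_of_cover[of a b "compl L a"] assms by simp
  show "b \<sqsubseteq> compl L a \<Longrightarrow> a \<sqinter> b = \<bottom>"
    using disjoint_mono[of b "compl L a" a] assms by (simp add: meet_comm)
qed

lemma le_iff_meet_compl:
  assumes "a \<in> carrier L" "b \<in> carrier L"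
  shows "a \<sqsubseteq> b \<longleftrightarrow> a \<sqinter> compl L b = \<bottom>"
  using le_compl_iff[of "compl L b" a] assms by (simp add: meet_comm)

lemma compl_antimono:
  assumes "a \<in> carrier L" "b \<in> carrier L" "a \<sqsubseteq> b"
  shows "compl L b \<sqsubseteq> compl L a"
  using assms le_compl_iff le_iff_meet_compl by simp

lemma le_bottom_iff: "a \<in> carrier L \<Longrightarrow> a \<sqsubseteq> \<bottom> \<longleftrightarrow> a = \<bottom>"
  by (metis bottom_closed bottom_lower le_antisym le_refl)

lemma le_compl_self: "a \<in> carrier L \<Longrightarrow> a \<sqsubseteq> compl L a \<Longrightarrow> a = \<bottom>"
  by (metis le_compl_iff le_iff_join le_refl)

lemma sup_empty [simp]: "\<Squnion>{} = \<bottom>"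
  using weak_sup_empty eq_is_equal by simp

text \<open>Stands in for the infinite distributive law, which is not among the axioms: if
  \<open>a\<close> were disjoint from every member of \<open>S\<close>, then
  \<open>compl L a\<close> would be an upper bound of \<open>S\<close>.\<close>

lemma meets_sup:
  assumes "S \<subseteq> carrier L" "a \<in> carrier L" "a \<sqinter> \<Squnion>S \<noteq> \<bottom>"
  shows "\<exists>s\<in>S. a \<sqinter> s \<noteq> \<bottom>"
proof (rule ccontr)
  assume "\<not> ?thesis"
  then have "\<Squnion>S \<sqsubseteq> compl L a"
    using assms by (intro sup_least) (auto simp: le_compl_iff)
  then show False using assms le_compl_iff by simp
qed

lemma nonbottom_sup:
  assumes "S \<subseteq> carrier L" "\<Squnion>S \<noteq> \<bottom>"
  shows "\<exists>s\<in>S. s \<noteq> \<bottom>"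
proof (rule ccontr)
  assume "\<not> ?thesis"
  then have "\<Squnion>S \<sqsubseteq> \<bottom>" using assms by (intro sup_least) auto
  then show False using assms le_bottom_iff by simp
qed

text \<open>De Morgan for arbitrary families, because \<open>compl\<close> is an order-reversing
  involution. It turns statements on meets of closed elements into statements on joins of
  opens.\<close>

lemma inf_eq_compl_sup:
  assumes "S \<subseteq> carrier L"
  shows "\<Sqinter>S = compl L (\<Squnion>(compl L ` S))"
proof (rule le_antisym)
  have c: "compl L ` S \<subseteq> carrier L" using assms by auto
  show "compl L (\<Squnion>(compl L ` S)) \<sqsubseteq> \<Sqinter>S"
  proof (rule inf_greatest)
    fix x assume x: "x \<in> S"
    have "compl L x \<sqsubseteq> \<Squnion>(compl L ` S)" using c x by (intro sup_upper) auto
    then show "compl L (\<Squnion>(compl L ` S)) \<sqsubseteq> x"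
      using compl_antimono[of "compl L x"] assms x c by auto
  qed (use assms c in auto)
  have "\<Squnion>(compl L ` S) \<sqsubseteq> compl L (\<Sqinter>S)"
  proof (rule sup_least)
    fix y assume "y \<in> compl L ` S"
    then obtain x where "x \<in> S" "y = compl L x" by auto
    then show "y \<sqsubseteq> compl L (\<Sqinter>S)"
      using compl_antimono[of "\<Sqinter>S" x] inf_lower assms by auto
  qed (use assms c in auto)
  then show "\<Sqinter>S \<sqsubseteq> compl L (\<Squnion>(compl L ` S))"
    using compl_antimono[of "\<Squnion>(compl L ` S)" "compl L (\<Sqinter>S)"] assms c by simp
qed (use assms in \<open>auto intro!: sup_closed inf_closed compl_closed\<close>)

end

section \<open>MT-algebras\<close>

context mt_algebra
begin

lemma box_mono:
  assumes "a \<in> carrier M" "b \<in> carrier M" "a \<sqsubseteq> b"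
  shows "mt_box M a \<sqsubseteq> mt_box M b"
proof -
  have "a = a \<sqinter> b" using assms le_iff_join by simp
  then have "mt_box M a = mt_box M a \<sqinter> mt_box M b" using assms box_meet by metis
  then show ?thesis using assms le_iff_join box_closed by simp
qed

lemma opens_carrier: "mt_opens M \<subseteq> carrier M"
  by (auto simp: mt_opens_def)

lemma box_open: "a \<in> carrier M \<Longrightarrow> mt_box M a \<in> mt_opens M"
  unfolding mt_opens_def by (auto intro: le_antisym simp: box_closed box_le box_idem)

lemma opensI: "a \<in> carrier M \<Longrightarrow> a \<sqsubseteq> mt_box M a \<Longrightarrow> a \<in> mt_opens M"
  unfolding mt_opens_def by (auto intro: le_antisym simp: box_closed box_le)

lemma opensD: "a \<in> mt_opens M \<Longrightarrow> mt_box M a = a"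
  by (simp add: mt_opens_def)

lemma top_open: "\<top> \<in> mt_opens M"
  by (simp add: mt_opens_def box_top)

lemma meet_open: "a \<in> mt_opens M \<Longrightarrow> b \<in> mt_opens M \<Longrightarrow> a \<sqinter> b \<in> mt_opens M"
  by (simp add: mt_opens_def box_meet)

lemma sup_open:
  assumes "S \<subseteq> mt_opens M"
  shows "\<Squnion>S \<in> mt_opens M"
proof (rule opensI)
  have S: "S \<subseteq> carrier M" using assms opens_carrier by blast
  then show "\<Squnion>S \<in> carrier M" by simp
  show "\<Squnion>S \<sqsubseteq> mt_box M (\<Squnion>S)"
  proof (rule sup_least[OF S])
    fix s assume s: "s \<in> S"
    then have "mt_box M s \<sqsubseteq> mt_box M (\<Squnion>S)" using S by (intro box_mono sup_upper) auto
    then show "s \<sqsubseteq> mt_box M (\<Squnion>S)" using opensD assms s by auto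
  qed (use S box_closed in simp)
qed

section \<open>Closed elements and the separation conditions\<close>

lemma closeds_carrier: "mt_closeds M \<subseteq> carrier M"
  by (auto simp: mt_closeds_def)

lemma closeds_iff: "a \<in> carrier M \<Longrightarrow> a \<in> mt_closeds M \<longleftrightarrow> compl M a \<in> mt_opens M"
  unfolding mt_closeds_def mt_opens_def mt_dia_def
  by (auto simp: box_closed) (metis box_closed compl_closed compl_compl)

lemma dia_closed: "a \<in> carrier M \<Longrightarrow> mt_dia M a \<in> mt_closeds M"
  by (subst closeds_iff) (auto simp: mt_dia_def box_closed box_open)

lemma inf_closeds:
  assumes "S \<subseteq> mt_closeds M"
  shows "\<Sqinter>S \<in> mt_closeds M"
proof -
  have S: "S \<subseteq> carrier M" using assms closeds_carrier by blast
  have "compl M ` S \<subseteq> mt_opens M" using assms S closeds_iff by blast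
  then show ?thesis
    using S sup_open opens_carrier by (subst closeds_iff) (auto simp: inf_eq_compl_sup)
qed

text \<open>The defining equation of \<open>mt_AC M\<close> exhibits its elements as meets of values
  of \<open>mt_dia M\<close>, which are closed.\<close>

lemma AC_subset_closeds: "mt_AC M \<subseteq> mt_closeds M"
proof
  fix a assume "a \<in> mt_AC M"
  then have "a = \<Sqinter>{mt_dia M (mt_box M c) |c. c \<in> carrier M \<and> a \<sqsubseteq> mt_box M c}"
    by (simp add: mt_AC_def)
  moreover have "\<dots> \<in> mt_closeds M"
    by (rule inf_closeds) (auto intro: dia_closed box_closed)
  ultimately show "a \<in> mt_closeds M" by simp
qed

lemma t1_of_hausdorff: "mt_hausdorff M \<Longrightarrow> mt_t1 M"
  unfolding mt_hausdorff_def mt_t1_def using AC_subset_closeds by (meson subset_trans)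

lemma closed_below:
  assumes "mt_t1 M" "a \<in> carrier M" "a \<noteq> \<bottom>"
  obtains c where "c \<in> mt_closeds M" "c \<noteq> \<bottom>" "c \<sqsubseteq> a"
proof -
  obtain S where S: "S \<subseteq> mt_closeds M" "a = \<Squnion>S" using assms unfolding mt_t1_def by blast
  then show thesis using that nonbottom_sup[of S] sup_upper[of S] assms closeds_carrier by blast
qed

section \<open>Atoms as completely prime elements, and their existence\<close>

lemma atoms_carrier: "mt_atoms M \<subseteq> carrier M"
  by (auto simp: mt_atoms_def)

lemma atom_le_iff:
  assumes "x \<in> mt_atoms M" "a \<in> carrier M"
  shows "x \<sqsubseteq> a \<longleftrightarrow> x \<sqinter> a \<noteq> \<bottom>"
proof
  assume "x \<sqinter> a \<noteq> \<bottom>"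
  then have "x \<sqinter> a = x"
    using assms meet_left[of x a] meet_closed[of x a] unfolding mt_atoms_def by blast
  then show "x \<sqsubseteq> a" using assms atoms_carrier by (metis meet_right subsetD)
next
  assume "x \<sqsubseteq> a"
  then have "x \<sqinter> a = x" using assms atoms_carrier le_iff_join by auto
  then show "x \<sqinter> a \<noteq> \<bottom>" using assms by (simp add: mt_atoms_def)
qed

lemma atom_le_compl_iff:
  assumes "x \<in> mt_atoms M" "a \<in> carrier M"
  shows "x \<sqsubseteq> compl M a \<longleftrightarrow> \<not> x \<sqsubseteq> a"
  using atom_le_iff[OF assms] le_compl_iff[of a x] assms atoms_carrier by (auto simp: meet_comm)

text \<open>For an atom, lying below an element means meeting it, and \<open>meets_sup\<close>
  passes from a join to one of its members. This primeness is what makes \<open>mt_eta M\<close>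
  send joins to unions.\<close>

lemma atom_le_sup_iff:
  assumes "x \<in> mt_atoms M" "S \<subseteq> carrier M"
  shows "x \<sqsubseteq> \<Squnion>S \<longleftrightarrow> (\<exists>s\<in>S. x \<sqsubseteq> s)"
proof
  assume "x \<sqsubseteq> \<Squnion>S"
  then show "\<exists>s\<in>S. x \<sqsubseteq> s"
    using assms atom_le_iff atoms_carrier meets_sup[of S x] by (meson subsetD sup_closed)
next
  assume "\<exists>s\<in>S. x \<sqsubseteq> s"
  then show "x \<sqsubseteq> \<Squnion>S"
    using assms atoms_carrier sup_upper by (meson le_trans subsetD sup_closed)
qed

lemma atom_le_inf_iff:
  assumes "x \<in> mt_atoms M" "S \<subseteq> carrier M"
  shows "x \<sqsubseteq> \<Sqinter>S \<longleftrightarrow> (\<forall>s\<in>S. x \<sqsubseteq> s)"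
  using assms atoms_carrier inf_lower inf_greatest by (meson le_trans subsetD inf_closed)

lemma atom_le_atom_iff: "x \<in> mt_atoms M \<Longrightarrow> y \<in> mt_atoms M \<Longrightarrow> x \<sqsubseteq> y \<longleftrightarrow> x = y"
  unfolding mt_atoms_def by auto

text \<open>A minimal nonzero closed element is an atom by \<open>T\<^sub>1\<close>; Zorn's lemma provides one below any
  nonzero closed element \<open>c \<le> k\<close> with \<open>k\<close> compact, since compactness keeps the meet of a chain of
  nonzero closed elements nonzero.\<close>

lemma inf_chain_nonbottom:
  assumes k: "mt_compact M k"
    and C: "C \<subseteq> mt_closeds M" "C \<noteq> {}" "\<And>d. d \<in> C \<Longrightarrow> d \<noteq> \<bottom> \<and> d \<sqsubseteq> k"
    and chain: "\<And>d e. d \<in> C \<Longrightarrow> e \<in> C \<Longrightarrow> d \<sqsubseteq> e \<or> e \<sqsubseteq> d"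
  shows "\<Sqinter>C \<noteq> \<bottom>"
proof
  assume "\<Sqinter>C = \<bottom>"
  have Cc: "C \<subseteq> carrier M" using C closeds_carrier by blast
  have op: "compl M ` C \<subseteq> mt_opens M" using C(1) Cc closeds_iff by blast
  have kc: "k \<in> carrier M" using k by (simp add: mt_compact_def)
  have sc: "\<Squnion>(compl M ` C) \<in> carrier M" using op opens_carrier by auto
  \<comment> \<open>If the meet vanished, the complements of the members of \<open>C\<close> would
    form an open cover of \<open>k\<close>.\<close>
  have "compl M (\<Squnion>(compl M ` C)) = \<bottom>"
    using inf_eq_compl_sup[OF Cc] \<open>\<Sqinter>C = \<bottom>\<close> by simp
  then have "k \<sqsubseteq> \<Squnion>(compl M ` C)"
    using le_iff_meet_compl[OF kc sc] kc by (metis bottom_closed bottom_lower le_bottom_iff meet_closed meet_right)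
  then obtain T where T: "T \<subseteq> compl M ` C" "finite T" "k \<sqsubseteq> \<Squnion>T"
    using k op unfolding mt_compact_def by blast
  then obtain D where D: "D \<subseteq> C" "finite D" "T = compl M ` D"
    by (meson finite_subset_image)
  \<comment> \<open>The lower bound is sought in \<open>C\<close> and not in \<open>D\<close>,
    because the finite subcover may be empty.\<close>
  have "\<exists>d\<in>C. \<forall>e\<in>D. d \<sqsubseteq> e"
    using D(2,1)
  proof (induction D)
    case empty
    then show ?case using C by auto
  next
    case (insert e D)
    then obtain d where d: "d \<in> C" "\<forall>e\<in>D. d \<sqsubseteq> e" by auto
    have ec: "e \<in> C" using insert.prems by auto
    have Dc: "D \<subseteq> carrier M" using insert.prems Cc by auto
    show ?case
    proof (cases "d \<sqsubseteq> e")
      case False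
      then have "e \<sqsubseteq> d" using chain d ec by blast
      then have "\<forall>x\<in>insert e D. e \<sqsubseteq> x"
        using d ec Cc Dc by (auto intro: le_trans[of e d])
      then show ?thesis using ec by blast
    qed (use d in auto)
  qed
  then obtain d where d: "d \<in> C" "\<forall>e\<in>D. d \<sqsubseteq> e" by blast
  have dc: "d \<in> carrier M" using d Cc by auto
  \<comment> \<open>The finite subcover lies below \<open>compl M d\<close>, so
    \<open>d \<sqsubseteq> k \<sqsubseteq> \<Squnion>T\<close> puts \<open>d\<close> below its own
    complement.\<close>
  have "\<Squnion>T \<sqsubseteq> compl M d"
    unfolding D(3) using D(1) Cc d dc by (intro sup_least) (auto intro!: compl_antimono)
  moreover have "T \<subseteq> carrier M" using T op opens_carrier by blast
  ultimately have "d \<sqsubseteq> compl M d"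
    using T(3) C(3)[OF d(1)] kc dc by (meson le_trans compl_closed sup_closed)
  then show False using le_compl_self dc C(3)[OF d(1)] by blast
qed

lemma atom_below_compact:
  assumes t1: "mt_t1 M" and k: "mt_compact M k"
    and c: "c \<in> mt_closeds M" "c \<noteq> \<bottom>" "c \<sqsubseteq> k"
  obtains x where "x \<in> mt_atoms M" "x \<sqsubseteq> c"
proof -
  define Z where "Z = {d \<in> mt_closeds M. d \<noteq> \<bottom> \<and> d \<sqsubseteq> c}"
  have kc: "k \<in> carrier M" using k by (simp add: mt_compact_def)
  have cc: "c \<in> carrier M" using c closeds_carrier by blast
  have Zc: "Z \<subseteq> carrier M" using closeds_carrier by (auto simp: Z_def)
  \<comment> \<open>The order is reversed so that Zorn's lemma, which yields maximal elements,
    yields a minimal one.\<close>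
  have po: "partial_order_on Z (relation_of (\<lambda>a b. b \<sqsubseteq> a) Z)"
    using Zc by (intro partial_order_on_relation_ofI) (auto intro: le_trans le_antisym)
  have "\<exists>m\<in>Z. \<forall>a\<in>Z. a \<sqsubseteq> m \<longrightarrow> a = m"
  proof (rule predicate_Zorn[OF po])
    fix C assume "C \<in> Chains (relation_of (\<lambda>a b. b \<sqsubseteq> a) Z)"
    then have C: "C \<subseteq> Z" "\<And>d e. d \<in> C \<Longrightarrow> e \<in> C \<Longrightarrow> d \<sqsubseteq> e \<or> e \<sqsubseteq> d"
      by (auto simp: Chains_def relation_of_def)
    show "\<exists>u\<in>Z. \<forall>a\<in>C. u \<sqsubseteq> a"
    proof (cases "C = {}")
      \<comment> \<open>The empty chain is bounded by \<open>c\<close>; its meet would be the top,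
        which need not lie in \<open>Z\<close>.\<close>
      case True
      then show ?thesis using c cc by (auto simp: Z_def)
    next
      case False
      have Cc: "C \<subseteq> carrier M" using C Zc by blast
      have "\<Sqinter>C \<noteq> \<bottom>"
        using C False c kc cc Cc by (intro inf_chain_nonbottom[OF k]) (auto simp: Z_def intro: le_trans)
      moreover have "\<Sqinter>C \<in> mt_closeds M"
        using C by (intro inf_closeds) (auto simp: Z_def)
      moreover obtain d where "d \<in> C" using False by blast
      then have "\<Sqinter>C \<sqsubseteq> c"
        using inf_lower[OF Cc] C Cc cc by (metis (no_types, lifting) Z_def inf_closed le_trans mem_Collect_eq subsetD)
      ultimately show ?thesis using inf_lower[OF Cc] by (auto simp: Z_def)
    qed
  qed
  then obtain m where m: "m \<in> Z" and min: "\<And>a. a \<in> Z \<Longrightarrow> a \<sqsubseteq> m \<Longrightarrow> a = m" by blast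
  have mc: "m \<in> carrier M" using m Zc by blast
  \<comment> \<open>Minimality concerns closed elements only. \<open>T\<^sub>1\<close> inserts a
    nonzero closed \<open>s\<close> below \<open>y\<close>, and \<open>s = m\<close> forces
    \<open>y = m\<close>.\<close>
  have "y = m" if y: "y \<in> carrier M" "y \<sqsubseteq> m" "y \<noteq> \<bottom>" for y
  proof -
    obtain s where s: "s \<in> mt_closeds M" "s \<noteq> \<bottom>" "s \<sqsubseteq> y" using closed_below[OF t1] y by metis
    have sc: "s \<in> carrier M" using s closeds_carrier by blast
    have "s \<sqsubseteq> m" using s y sc mc by (meson le_trans)
    moreover have "s \<sqsubseteq> c" using calculation m sc mc cc by (auto simp: Z_def intro: le_trans)
    ultimately have "s = m" using s min by (auto simp: Z_def)
    then show ?thesis using s y mc by (auto intro: le_antisym)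
  qed
  then show thesis using that[of m] m mc by (auto simp: Z_def mt_atoms_def)
qed

end

text \<open>Isolates what transport along \<open>mt_eta M\<close> relies on, so that the transfer
  lemmas serve both classes of algebras.\<close>

locale atomic_mt_algebra = mt_algebra +
  assumes atom_below: "\<lbrakk>a \<in> carrier M; a \<noteq> \<bottom>\<rbrakk> \<Longrightarrow> \<exists>x\<in>mt_atoms M. x \<sqsubseteq> a"

lemma (in mt_algebra) atomic:
  assumes t1: "mt_t1 M" and lc: "mt_locally_compact M"
  shows "atomic_mt_algebra M"
proof unfold_locales
  fix a assume a: "a \<in> carrier M" "a \<noteq> \<bottom>"
  \<comment> \<open>Local compactness at the top makes \<open>a\<close> meet some open
    \<open>v\<close> that lies below a compact \<open>k\<close>. A nonzero closed element below
    \<open>a \<sqinter> v\<close> is then below both \<open>a\<close> and \<open>k\<close>.\<close>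
  let ?V = "{v \<in> mt_opens M. mt_way_below M v \<top>}"
  have V: "\<top> = \<Squnion>?V" using lc top_open unfolding mt_locally_compact_def by blast
  have "a \<sqinter> \<top> = a" using a by (metis le_iff_join top_closed top_higher)
  then have "a \<sqinter> \<Squnion>?V \<noteq> \<bottom>" using a V by simp
  then obtain v where v: "v \<in> ?V" "a \<sqinter> v \<noteq> \<bottom>"
    using meets_sup[of ?V a] a opens_carrier by blast
  then obtain k where k: "mt_compact M k" "v \<sqsubseteq> k" unfolding mt_way_below_def by blast
  have vc: "v \<in> carrier M" using v opens_carrier by blast
  have kc: "k \<in> carrier M" using k by (simp add: mt_compact_def)
  obtain c where c: "c \<in> mt_closeds M" "c \<noteq> \<bottom>" "c \<sqsubseteq> a \<sqinter> v"
    using closed_below[OF t1 _ v(2)] a vc by (metis meet_closed)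
  have cc: "c \<in> carrier M" using c closeds_carrier by blast
  have "c \<sqsubseteq> a" "c \<sqsubseteq> k"
    using c k a vc cc kc by (meson le_trans meet_closed meet_left meet_right)+
  then obtain x where x: "x \<in> mt_atoms M" "x \<sqsubseteq> c" using atom_below_compact[OF t1 k(1)] c by metis
  then show "\<exists>x\<in>mt_atoms M. x \<sqsubseteq> a"
    using \<open>c \<sqsubseteq> a\<close> cc a atoms_carrier by (meson le_trans subsetD)
qed

section \<open>The powerset algebra of a space\<close>

lemma pow_mt_simps [simp]:
  "carrier (pow_mt X) = Pow (topspace X)"
  "le (pow_mt X) = (\<subseteq>)"
  "mt_box (pow_mt X) A = X interior_of A"
  by (simp_all add: pow_mt_def)

lemma complete_lattice_pow_mt: "Complete_Lattice.complete_lattice (pow_mt X)"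
proof -
  interpret partial_order "pow_mt X"
    by unfold_locales (auto simp: pow_mt_def)
  show ?thesis
  proof (rule complete_latticeI)
    fix S assume S: "S \<subseteq> carrier (pow_mt X)"
    have "least (pow_mt X) (\<Union>S) (Upper (pow_mt X) S)"
    proof (rule least_UpperI)
      fix y assume "y \<in> Upper (pow_mt X) S"
      then show "\<Union>S \<sqsubseteq>\<^bsub>pow_mt X\<^esub> y" using S Upper_memD[of y "pow_mt X" S] by (simp add: Union_least)
    qed (use S in auto)
    then show "\<exists>s. is_lub (pow_mt X) s S" by blast
    \<comment> \<open>The factor \<open>topspace X\<close> matters for empty \<open>S\<close>, where
      \<open>\<Inter>S\<close> is the whole type.\<close>
    have "greatest (pow_mt X) (topspace X \<inter> \<Inter>S) (Lower (pow_mt X) S)"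
    proof (rule greatest_LowerI)
      fix y assume "y \<in> Lower (pow_mt X) S"
      then show "y \<sqsubseteq>\<^bsub>pow_mt X\<^esub> topspace X \<inter> \<Inter>S"
        using S Lower_memD[of y "pow_mt X" S] subsetD[OF Lower_closed] by (fastforce simp: Inter_greatest)
    qed (use S in auto)
    then show "\<exists>s. is_glb (pow_mt X) s S" by blast
  qed
qed

lemma sup_pow_mt: "S \<subseteq> Pow (topspace X) \<Longrightarrow> \<Squnion>\<^bsub>pow_mt X\<^esub> S = \<Union>S"
proof -
  assume S: "S \<subseteq> Pow (topspace X)"
  interpret Complete_Lattice.complete_lattice "pow_mt X" by (rule complete_lattice_pow_mt)
  have "\<Squnion>\<^bsub>pow_mt X\<^esub> S \<subseteq> \<Union>S" using S sup_least[of S "\<Union>S"] by auto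
  moreover have "\<Union>S \<subseteq> \<Squnion>\<^bsub>pow_mt X\<^esub> S" using S sup_upper[of S] by (intro Union_least) simp
  ultimately show ?thesis by blast
qed

lemma inf_pow_mt: "S \<subseteq> Pow (topspace X) \<Longrightarrow> \<Sqinter>\<^bsub>pow_mt X\<^esub> S = topspace X \<inter> \<Inter>S"
proof -
  assume S: "S \<subseteq> Pow (topspace X)"
  interpret Complete_Lattice.complete_lattice "pow_mt X" by (rule complete_lattice_pow_mt)
  have "topspace X \<inter> \<Inter>S \<subseteq> \<Sqinter>\<^bsub>pow_mt X\<^esub> S"
    using S inf_greatest[of S "topspace X \<inter> \<Inter>S"] by auto
  moreover have "\<Sqinter>\<^bsub>pow_mt X\<^esub> S \<subseteq> \<Inter>S" using S inf_lower[of S] by (intro Inter_greatest) simp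
  moreover have "\<Sqinter>\<^bsub>pow_mt X\<^esub> S \<subseteq> topspace X" using S inf_closed[of S] by simp
  ultimately show ?thesis by blast
qed

lemma join_pow_mt: "\<lbrakk>A \<subseteq> topspace X; B \<subseteq> topspace X\<rbrakk> \<Longrightarrow> A \<squnion>\<^bsub>pow_mt X\<^esub> B = A \<union> B"
  by (simp add: join_def sup_pow_mt)

lemma meet_pow_mt: "\<lbrakk>A \<subseteq> topspace X; B \<subseteq> topspace X\<rbrakk> \<Longrightarrow> A \<sqinter>\<^bsub>pow_mt X\<^esub> B = A \<inter> B"
  by (auto simp add: meet_def inf_pow_mt)

lemma top_pow_mt: "\<top>\<^bsub>pow_mt X\<^esub> = topspace X"
proof -
  interpret Complete_Lattice.complete_lattice "pow_mt X" by (rule complete_lattice_pow_mt)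
  show ?thesis using top_closed top_higher[of "topspace X"] by auto
qed

lemma bottom_pow_mt: "\<bottom>\<^bsub>pow_mt X\<^esub> = {}"
proof -
  interpret Complete_Lattice.complete_lattice "pow_mt X" by (rule complete_lattice_pow_mt)
  show ?thesis using bottom_lower[of "{}"] by auto
qed

lemma mt_algebra_pow_mt: "mt_algebra (pow_mt X)"
proof -
  interpret Complete_Lattice.complete_lattice "pow_mt X" by (rule complete_lattice_pow_mt)
  show ?thesis
  proof unfold_locales
    fix A B C
    assume "A \<in> carrier (pow_mt X)" "B \<in> carrier (pow_mt X)" "C \<in> carrier (pow_mt X)"
    then have "A \<subseteq> topspace X" "B \<subseteq> topspace X" "C \<subseteq> topspace X"
      "B \<union> C \<subseteq> topspace X" "A \<inter> B \<subseteq> topspace X" "A \<inter> C \<subseteq> topspace X" by auto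
    then show "A \<sqinter>\<^bsub>pow_mt X\<^esub> (B \<squnion>\<^bsub>pow_mt X\<^esub> C)
        = (A \<sqinter>\<^bsub>pow_mt X\<^esub> B) \<squnion>\<^bsub>pow_mt X\<^esub> (A \<sqinter>\<^bsub>pow_mt X\<^esub> C)"
      by (simp add: join_pow_mt meet_pow_mt Int_Un_distrib)
  next
    fix A assume "A \<in> carrier (pow_mt X)"
    then have "topspace X - A \<in> carrier (pow_mt X)" "A \<sqinter>\<^bsub>pow_mt X\<^esub> (topspace X - A) = \<bottom>\<^bsub>pow_mt X\<^esub>"
        "A \<squnion>\<^bsub>pow_mt X\<^esub> (topspace X - A) = \<top>\<^bsub>pow_mt X\<^esub>"
      by (auto simp: join_pow_mt meet_pow_mt top_pow_mt bottom_pow_mt)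
    then show "\<exists>B\<in>carrier (pow_mt X). A \<sqinter>\<^bsub>pow_mt X\<^esub> B = \<bottom>\<^bsub>pow_mt X\<^esub> \<and> A \<squnion>\<^bsub>pow_mt X\<^esub> B = \<top>\<^bsub>pow_mt X\<^esub>"
      by blast
  qed (use interior_of_subset_topspace[of X] interior_of_subset[of X] in
      \<open>auto simp: meet_pow_mt top_pow_mt interior_of_Int\<close>)
qed

lemma compl_pow_mt: "A \<subseteq> topspace X \<Longrightarrow> compl (pow_mt X) A = topspace X - A"
proof -
  assume A: "A \<subseteq> topspace X"
  interpret mt_algebra "pow_mt X" by (rule mt_algebra_pow_mt)
  show ?thesis
    using A by (intro compl_eqI) (auto simp: join_pow_mt meet_pow_mt top_pow_mt bottom_pow_mt)
qed

section \<open>Topological notions of a space read in its powerset algebra\<close>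

lemma opens_pow_mt: "mt_opens (pow_mt X) = {U. openin X U}"
proof -
  have "A = X interior_of A \<longleftrightarrow> openin X A" for A by (subst eq_commute) (rule interior_of_eq)
  then show ?thesis
    unfolding mt_opens_def pow_mt_simps by (intro Collect_cong) (metis PowI openin_subset)
qed

lemma dia_pow_mt: "A \<subseteq> topspace X \<Longrightarrow> mt_dia (pow_mt X) A = X closure_of A"
  by (simp add: mt_dia_def compl_pow_mt interior_of_subset_topspace closure_of_interior_of)

lemma closeds_pow_mt: "mt_closeds (pow_mt X) = {C. closedin X C}"
proof -
  have "A = mt_dia (pow_mt X) A \<longleftrightarrow> closedin X A" if "A \<subseteq> topspace X" for A
    unfolding dia_pow_mt[OF that] by (subst eq_commute) (rule closure_of_eq)
  then show ?thesis
    unfolding mt_closeds_def pow_mt_simps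
    by (intro Collect_cong) (metis PowD PowI closedin_subset)
qed

text \<open>On families of open sets the joins of the algebra are unions; any other family satisfies
  both covering conditions vacuously.\<close>

lemma compact_pow_mt: "mt_compact (pow_mt X) K \<longleftrightarrow> compactin X K"
proof -
  have sup: "\<Squnion>\<^bsub>pow_mt X\<^esub> S = \<Union>S" if "\<forall>U\<in>S. openin X U" for S
    using that by (intro sup_pow_mt) (auto dest: openin_subset)
  have "(\<forall>S\<subseteq>{U. openin X U}. K \<subseteq> \<Squnion>\<^bsub>pow_mt X\<^esub> S \<longrightarrow> (\<exists>T\<subseteq>S. finite T \<and> K \<subseteq> \<Squnion>\<^bsub>pow_mt X\<^esub> T))
    \<longleftrightarrow> (\<forall>S. (\<forall>U\<in>S. openin X U) \<and> K \<subseteq> \<Union>S \<longrightarrow> (\<exists>T. finite T \<and> T \<subseteq> S \<and> K \<subseteq> \<Union>T))"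
    (is "(\<forall>S. ?P S) \<longleftrightarrow> (\<forall>S. ?Q S)")
  proof (rule all_cong1)
    fix S
    show "?P S \<longleftrightarrow> ?Q S"
    proof (cases "\<forall>U\<in>S. openin X U")
      case True
      then have "\<Squnion>\<^bsub>pow_mt X\<^esub> T = \<Union>T" if "T \<subseteq> S" for T using that sup by blast
      then have "(\<exists>T\<subseteq>S. finite T \<and> K \<subseteq> \<Squnion>\<^bsub>pow_mt X\<^esub> T) \<longleftrightarrow> (\<exists>T. finite T \<and> T \<subseteq> S \<and> K \<subseteq> \<Union>T)"
        by metis
      moreover have "S \<subseteq> {U. openin X U}" using True by blast
      ultimately show ?thesis using True sup[of S] by simp
    qed blast
  qed
  then show ?thesis
    by (simp add: mt_compact_def compactin_def opens_pow_mt)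
qed

lemma saturated_pow_mt: "mt_saturated (pow_mt X) K \<longleftrightarrow> saturated_in X K"
proof -
  have "\<Sqinter>\<^bsub>pow_mt X\<^esub> S = topspace X \<inter> \<Inter>S" if "S \<subseteq> mt_opens (pow_mt X)" for S
    using that by (intro inf_pow_mt) (auto simp: opens_pow_mt dest: openin_subset)
  moreover have "S \<subseteq> mt_opens (pow_mt X) \<longleftrightarrow> (\<forall>U\<in>S. openin X U)" for S
    by (auto simp: opens_pow_mt)
  ultimately show ?thesis
    unfolding mt_saturated_def saturated_in_def by metis
qed

lemma KS_pow_mt: "mt_KS (pow_mt X) = {K. compactin X K \<and> saturated_in X K}"
  by (simp add: mt_KS_def compact_pow_mt saturated_pow_mt)

text \<open>The meet in \<open>mt_AC\<close> is the intersection of the closures of the open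
  neighbourhoods of \<open>x\<close>. Disjoint neighbourhoods \<open>U\<close> of \<open>x\<close>
  and \<open>V\<close> of \<open>y\<close> keep \<open>y\<close> out of the closure of
  \<open>U\<close>, so only \<open>x\<close> survives.\<close>

lemma singleton_AC_pow_mt:
  assumes "Hausdorff_space X" "x \<in> topspace X"
  shows "{x} \<in> mt_AC (pow_mt X)"
proof -
  let ?I = "{C \<in> Pow (topspace X). {x} \<subseteq> X interior_of C}"
  let ?cl = "\<lambda>C. X closure_of (X interior_of C)"
  have "topspace X \<inter> \<Inter>(?cl ` ?I) = {x}"
  proof (intro equalityI subsetI)
    fix y assume y: "y \<in> topspace X \<inter> \<Inter>(?cl ` ?I)"
    show "y \<in> {x}"
    proof (rule ccontr)
      assume "y \<notin> {x}"
      then have "x \<noteq> y" "y \<in> topspace X" using y by blast+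
      then obtain U V where UV: "openin X U" "openin X V" "x \<in> U" "y \<in> V" "disjnt U V"
        using assms unfolding Hausdorff_space_def by metis
      have U: "U \<subseteq> topspace X" "X interior_of U = U"
        using UV(1) by (simp_all add: openin_subset interior_of_openin)
      then have "U \<in> ?I" using UV(3) by simp
      then have "y \<in> ?cl U" using y by blast
      then have "y \<in> X closure_of U" using U(2) by simp
      then show False using UV(2,4,5) unfolding in_closure_of disjnt_def by blast
    qed
  next
    fix y assume y: "y \<in> {x}"
    have "y \<in> X closure_of (X interior_of C)" if "{x} \<subseteq> X interior_of C" for C
      using that y closure_of_subset[OF interior_of_subset_topspace[of X C]] by blast
    then show "y \<in> topspace X \<inter> \<Inter>(?cl ` ?I)"
      using assms(2) y by auto
  qed
  moreover have "\<Sqinter>\<^bsub>pow_mt X\<^esub> (?cl ` ?I) = topspace X \<inter> \<Inter>(?cl ` ?I)"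
    using closure_of_subset_topspace[of X] by (intro inf_pow_mt) blast
  \<comment> \<open>The family in the definition of \<open>mt_AC\<close> is rewritten as an image so
    that each \<open>mt_dia\<close> can be replaced by a closure.\<close>
  moreover have "{mt_dia (pow_mt X) (X interior_of C) |C. C \<in> Pow (topspace X) \<and> {x} \<subseteq> X interior_of C}
      = ?cl ` ?I"
    unfolding setcompr_eq_image by (intro image_cong refl dia_pow_mt interior_of_subset_topspace)
  ultimately show ?thesis unfolding mt_AC_def pow_mt_simps using assms(2) by simp
qed

lemma sup_singletons_pow_mt:
  "A \<subseteq> topspace X \<Longrightarrow> \<Squnion>\<^bsub>pow_mt X\<^esub> ((\<lambda>x. {x}) ` A) = A"
  by (subst sup_pow_mt) auto

lemma hausdorff_pow_mt:
  assumes "Hausdorff_space X"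
  shows "mt_hausdorff (pow_mt X)"
  unfolding mt_hausdorff_def
proof
  fix A assume "A \<in> carrier (pow_mt X)"
  then have A: "A \<subseteq> topspace X" by simp
  then have "(\<lambda>x. {x}) ` A \<subseteq> mt_AC (pow_mt X)" using singleton_AC_pow_mt[OF assms] by blast
  then show "\<exists>S\<subseteq>mt_AC (pow_mt X). A = \<Squnion>\<^bsub>pow_mt X\<^esub> S" using sup_singletons_pow_mt[OF A] by metis
qed

text \<open>\<open>locally_compact_space\<close> provides one compact neighbourhood of each point,
  while the algebraic condition asks for compact sets inside a given open. The Hausdorff property
  supplies a neighbourhood base of compact sets.\<close>

lemma locally_compact_pow_mt:
  assumes "Hausdorff_space X" "locally_compact_space X"
  shows "mt_locally_compact (pow_mt X)"
  unfolding mt_locally_compact_def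
proof
  fix U assume "U \<in> mt_opens (pow_mt X)"
  then have U: "openin X U" by (simp add: opens_pow_mt)
  let ?S = "{V \<in> mt_opens (pow_mt X). mt_way_below (pow_mt X) V U}"
  have S: "?S = {V. openin X V \<and> (\<exists>K. compactin X K \<and> V \<subseteq> K \<and> K \<subseteq> U)}"
    by (auto simp: opens_pow_mt mt_way_below_def compact_pow_mt)
  have nb: "neighbourhood_base_of (compactin X) X"
    using assms locally_compact_space_neighbourhood_base by blast
  have "U \<subseteq> \<Union>?S"
  proof
    fix x assume "x \<in> U"
    then obtain V K where "openin X V" "compactin X K" "x \<in> V" "V \<subseteq> K" "K \<subseteq> U"
      using U nb unfolding neighbourhood_base_of by meson
    then show "x \<in> \<Union>?S" unfolding S by blast
  qed
  then have "U = \<Union>?S" unfolding S by blast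
  moreover have "\<Squnion>\<^bsub>pow_mt X\<^esub> ?S = \<Union>?S"
    by (rule sup_pow_mt) (auto simp: opens_pow_mt dest: openin_subset)
  ultimately show "U = \<Squnion>\<^bsub>pow_mt X\<^esub> ?S" by simp
qed

lemma zero_dimensional_pow_mt:
  assumes "zero_dimensional_space X"
  shows "mt_zero_dimensional (pow_mt X)"
  unfolding mt_zero_dimensional_def
proof (intro conjI ballI)
  have "t1_space X" using assms by (simp add: zero_dimensional_space_def)
  then have "(\<lambda>x. {x}) ` A \<subseteq> mt_closeds (pow_mt X)" if "A \<subseteq> topspace X" for A
    using that by (auto simp: closeds_pow_mt t1_space_closedin_singleton)
  then show "mt_t1 (pow_mt X)"
    unfolding mt_t1_def pow_mt_simps(1) Ball_def Pow_iff using sup_singletons_pow_mt by metis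
next
  fix U assume "U \<in> mt_opens (pow_mt X)"
  then have "openin X U" by (simp add: opens_pow_mt)
  then have "(arbitrary union_of (\<lambda>U. openin X U \<and> closedin X U)) U"
    using assms by (simp add: zero_dimensional_space_def)
  then obtain \<U> where \<U>: "\<U> \<subseteq> {U. openin X U \<and> closedin X U}" "\<Union>\<U> = U"
    by (auto simp: union_of_def)
  let ?S = "{V \<in> mt_clopens (pow_mt X). V \<subseteq> U}"
  \<comment> \<open>Some clopen family has union \<open>U\<close>, so the family of all clopens
    below \<open>U\<close> does as well.\<close>
  have "\<U> \<subseteq> ?S" using \<U> by (auto simp: mt_clopens_def opens_pow_mt closeds_pow_mt)
  then have "\<Union>?S = U" using \<U>(2) by blast
  moreover have "\<Squnion>\<^bsub>pow_mt X\<^esub> ?S = \<Union>?S"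
    by (rule sup_pow_mt) (auto simp: mt_clopens_def opens_pow_mt dest: openin_subset)
  ultimately show "U = \<Squnion>\<^bsub>pow_mt X\<^esub> {V \<in> mt_clopens (pow_mt X). V \<sqsubseteq>\<^bsub>pow_mt X\<^esub> U}"
    by simp
qed

lemma atoms_pow_mt: "mt_atoms (pow_mt X) = (\<lambda>x. {x}) ` topspace X"
proof (intro equalityI subsetI)
  fix A assume A: "A \<in> mt_atoms (pow_mt X)"
  then have sub: "A \<subseteq> topspace X" and "A \<noteq> {}" by (auto simp: mt_atoms_def bottom_pow_mt)
  then obtain x where x: "x \<in> A" by blast
  then have "{x} = A" using A sub unfolding mt_atoms_def bottom_pow_mt by auto
  then show "A \<in> (\<lambda>x. {x}) ` topspace X" using sub by blast
qed (auto simp: mt_atoms_def bottom_pow_mt)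

section \<open>The space of atoms\<close>

context mt_algebra
begin

lemma eta_top: "mt_eta M \<top> = mt_atoms M"
  using atoms_carrier by (auto simp: mt_eta_def)

lemma eta_sup: "S \<subseteq> carrier M \<Longrightarrow> mt_eta M (\<Squnion>S) = \<Union>(mt_eta M ` S)"
  by (auto simp: mt_eta_def atom_le_sup_iff)

lemma eta_inf: "S \<subseteq> carrier M \<Longrightarrow> mt_eta M (\<Sqinter>S) = mt_atoms M \<inter> \<Inter>(mt_eta M ` S)"
  by (auto simp: mt_eta_def atom_le_inf_iff)

lemma eta_meet: "a \<in> carrier M \<Longrightarrow> b \<in> carrier M \<Longrightarrow> mt_eta M (a \<sqinter> b) = mt_eta M a \<inter> mt_eta M b"
  unfolding meet_def by (subst eta_inf) (auto simp: mt_eta_def)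

lemma eta_compl: "a \<in> carrier M \<Longrightarrow> mt_eta M (compl M a) = mt_atoms M - mt_eta M a"
  by (auto simp: mt_eta_def atom_le_compl_iff)

lemma eta_mono: "a \<in> carrier M \<Longrightarrow> b \<in> carrier M \<Longrightarrow> a \<sqsubseteq> b \<Longrightarrow> mt_eta M a \<subseteq> mt_eta M b"
  unfolding mt_eta_def using atoms_carrier le_trans[of _ a b] by auto

text \<open>An atom below \<open>\<Squnion>A\<close> is below a member of \<open>A\<close>, hence
  equal to it. So \<open>mt_eta M\<close> is onto the sets of atoms, with the join as a
  preimage.\<close>

lemma eta_sup_atoms: "A \<subseteq> mt_atoms M \<Longrightarrow> mt_eta M (\<Squnion>A) = A"
proof -
  assume A: "A \<subseteq> mt_atoms M"
  have "mt_eta M x = {x}" if "x \<in> mt_atoms M" for x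
    using that by (auto simp: mt_eta_def atom_le_atom_iff)
  then have "mt_eta M ` A = (\<lambda>x. {x}) ` A" using A by (intro image_cong) auto
  then show ?thesis using eta_sup[of A] A atoms_carrier by auto
qed

text \<open>\<open>at_space\<close> is built with \<open>topology\<close>, so its open sets are
  known only after the images of opens are shown to form a topology. This follows as
  \<open>mt_eta M\<close> sends binary meets and joins to intersections and unions.\<close>

lemma openin_at_space: "openin (at_space M) U \<longleftrightarrow> (\<exists>a\<in>mt_opens M. U = mt_eta M a)"
proof -
  have "istopology (\<lambda>U. \<exists>a\<in>mt_opens M. U = mt_eta M a)"
    unfolding istopology_def
  proof (intro conjI allI impI)
    fix U V
    assume "\<exists>a\<in>mt_opens M. U = mt_eta M a" "\<exists>a\<in>mt_opens M. V = mt_eta M a"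
    then obtain a b where "a \<in> mt_opens M" "b \<in> mt_opens M" "U = mt_eta M a" "V = mt_eta M b"
      by blast
    then show "\<exists>a\<in>mt_opens M. U \<inter> V = mt_eta M a"
      using eta_meet[of a b] meet_open[of a b] opens_carrier by blast
  next
    fix \<K> assume K: "\<forall>K\<in>\<K>. \<exists>a\<in>mt_opens M. K = mt_eta M a"
    \<comment> \<open>Taking all opens whose image is in \<open>\<K>\<close> avoids choosing a
      representative of each member.\<close>
    let ?S = "{a \<in> mt_opens M. mt_eta M a \<in> \<K>}"
    have "mt_eta M (\<Squnion>?S) = \<Union>(mt_eta M ` ?S)"
      using opens_carrier by (intro eta_sup) auto
    also have "mt_eta M ` ?S = \<K>" using K by auto
    finally show "\<exists>a\<in>mt_opens M. \<Union>\<K> = mt_eta M a"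
      using sup_open[of ?S] by auto
  qed
  then show ?thesis by (simp add: at_space_def topology_inverse')
qed

lemma open_eta: "a \<in> mt_opens M \<Longrightarrow> openin (at_space M) (mt_eta M a)"
  using openin_at_space by metis

text \<open>Lifts a family of open sets to a family of open elements; it serves for covers and for
  saturation alike.\<close>

lemma opens_at_space_eq_image:
  assumes "\<forall>U\<in>\<U>. openin (at_space M) U"
  shows "\<U> = mt_eta M ` {s \<in> mt_opens M. mt_eta M s \<in> \<U>}"
proof (intro equalityI subsetI)
  fix U assume "U \<in> \<U>"
  moreover from this obtain s where "s \<in> mt_opens M" "U = mt_eta M s"
    using assms openin_at_space[of U] by metis
  ultimately show "U \<in> mt_eta M ` {s \<in> mt_opens M. mt_eta M s \<in> \<U>}" by blast
qed blast

lemma topspace_at_space [simp]: "topspace (at_space M) = mt_atoms M"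
proof
  show "topspace (at_space M) \<subseteq> mt_atoms M"
    using openin_topspace[of "at_space M"] unfolding openin_at_space mt_eta_def by auto
  show "mt_atoms M \<subseteq> topspace (at_space M)"
    using openin_subset[of "at_space M" "mt_atoms M"] openin_at_space eta_top top_open by metis
qed

lemma Hausdorff_at_space:
  assumes "mt_hausdorff M"
  shows "Hausdorff_space (at_space M)"
  unfolding Hausdorff_space_def
proof (intro allI impI)
  fix x y assume "x \<in> topspace (at_space M) \<and> y \<in> topspace (at_space M) \<and> x \<noteq> y"
  then have x: "x \<in> mt_atoms M" and y: "y \<in> mt_atoms M" and "x \<noteq> y" by auto
  then have xc: "x \<in> carrier M" and yc: "y \<in> carrier M" using atoms_carrier by auto
  let ?F = "{mt_dia M (mt_box M c) |c. c \<in> carrier M \<and> x \<sqsubseteq> mt_box M c}"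
  have F: "?F \<subseteq> carrier M" using dia_closed closeds_carrier box_closed by blast
  obtain S where S: "S \<subseteq> mt_AC M" "x = \<Squnion>S"
    using assms xc unfolding mt_hausdorff_def by blast
  have Sc: "S \<subseteq> carrier M" using S AC_subset_closeds closeds_carrier by blast
  then obtain s where s: "s \<in> S" "x \<sqsubseteq> s"
    using atom_le_sup_iff[OF x Sc] S(2) xc by auto
  moreover have "s \<sqsubseteq> x" using sup_upper[OF Sc s(1)] S by simp
  \<comment> \<open>Primeness forces an atom that is a join of elements of \<open>mt_AC M\<close> to
    be one of them.\<close>
  ultimately have "x \<in> mt_AC M" using S(1) Sc xc by (metis le_antisym subsetD)
  then have "x = \<Sqinter>?F" by (simp add: mt_AC_def)
  then have "\<not> y \<sqsubseteq> \<Sqinter>?F" using atom_le_atom_iff x y \<open>x \<noteq> y\<close> by metis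
  then obtain c where c: "c \<in> carrier M" "x \<sqsubseteq> mt_box M c" "\<not> y \<sqsubseteq> mt_dia M (mt_box M c)"
    using atom_le_inf_iff[OF y F] by blast
  \<comment> \<open>The separating opens are \<open>mt_box M c\<close> around \<open>x\<close> and
    the complement of its closure around \<open>y\<close>.\<close>
  let ?d = "compl M (mt_dia M (mt_box M c))"
  have bc: "mt_box M c \<in> carrier M" using c box_closed by blast
  have dc: "mt_dia M (mt_box M c) \<in> mt_closeds M" using bc dia_closed by blast
  then have dc': "mt_dia M (mt_box M c) \<in> carrier M" using closeds_carrier by blast
  have d: "?d \<in> mt_opens M" using dc dc' closeds_iff by blast
  have "?d \<sqsubseteq> compl M (mt_box M c)"
    unfolding mt_dia_def using bc box_le by (simp add: box_closed)
  then have "mt_eta M ?d \<subseteq> mt_atoms M - mt_eta M (mt_box M c)"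
    using eta_mono[of ?d "compl M (mt_box M c)"] bc dc' by (simp add: eta_compl)
  then have "disjnt (mt_eta M (mt_box M c)) (mt_eta M ?d)" by (auto simp: disjnt_def)
  moreover have "x \<in> mt_eta M (mt_box M c)" using x c by (simp add: mt_eta_def)
  moreover have "y \<in> mt_eta M ?d" using y c dc' by (simp add: mt_eta_def atom_le_compl_iff)
  moreover have "openin (at_space M) (mt_eta M (mt_box M c))" "openin (at_space M) (mt_eta M ?d)"
    using open_eta d box_open[OF c(1)] by simp_all
  ultimately show "\<exists>U V. openin (at_space M) U \<and> openin (at_space M) V \<and> x \<in> U \<and> y \<in> V \<and> disjnt U V"
    by blast
qed

lemma closedin_eta:
  assumes "a \<in> mt_closeds M"
  shows "closedin (at_space M) (mt_eta M a)"
proof -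
  have ac: "a \<in> carrier M" using assms closeds_carrier by blast
  have "compl M a \<in> mt_opens M" using assms closeds_iff ac by blast
  then have "openin (at_space M) (mt_atoms M - mt_eta M a)"
    using eta_compl[OF ac] openin_at_space by metis
  then show ?thesis by (auto simp: closedin_def mt_eta_def)
qed

text \<open>\<open>mt_eta M\<close> sends clopens to clopens and the join of the clopens below an
  open to a union. The hypothesis \<open>t1\<close> is later supplied by the Hausdorff property of
  the space of atoms.\<close>

lemma zero_dimensional_at_space:
  assumes zd: "mt_zero_dimensional M" and t1: "t1_space (at_space M)"
  shows "zero_dimensional_space (at_space M)"
proof -
  have "(arbitrary union_of (\<lambda>U. openin (at_space M) U \<and> closedin (at_space M) U)) U"
    if U: "openin (at_space M) U" for U
  proof -
    obtain a where a: "a \<in> mt_opens M" "U = mt_eta M a" using U openin_at_space[of U] by metis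
    let ?S = "{b \<in> mt_clopens M. b \<sqsubseteq> a}"
    have S: "?S \<subseteq> carrier M" using opens_carrier by (auto simp: mt_clopens_def)
    have "a = \<Squnion>?S" using zd a by (simp add: mt_zero_dimensional_def)
    then have "U = \<Union>(mt_eta M ` ?S)" using eta_sup[OF S] a by simp
    moreover have "openin (at_space M) V \<and> closedin (at_space M) V" if "V \<in> mt_eta M ` ?S" for V
      using that closedin_eta open_eta by (auto simp: mt_clopens_def)
    ultimately show ?thesis unfolding union_of_def arbitrary_def by blast
  qed
  moreover have "openin (at_space M) U"
    if "(arbitrary union_of (\<lambda>U. openin (at_space M) U \<and> closedin (at_space M) U)) U" for U
    using that unfolding union_of_def by (auto intro: openin_Union)
  ultimately show ?thesis
    unfolding zero_dimensional_space_def using t1 by blast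
qed

end

section \<open>Transfer along \<open>mt_eta M\<close> in atomic algebras\<close>

context atomic_mt_algebra
begin

text \<open>If \<open>a \<sqsubseteq> b\<close> fails, an atom below
  \<open>a \<sqinter> compl M b\<close> lies in \<open>mt_eta M a\<close> and not in
  \<open>mt_eta M b\<close>. This is the point where \<open>atom_below\<close> is used.\<close>

lemma eta_subset_iff:
  assumes "a \<in> carrier M" "b \<in> carrier M"
  shows "mt_eta M a \<subseteq> mt_eta M b \<longleftrightarrow> a \<sqsubseteq> b"
proof
  assume sub: "mt_eta M a \<subseteq> mt_eta M b"
  show "a \<sqsubseteq> b"
  proof (rule ccontr)
    assume "\<not> a \<sqsubseteq> b"
    then have "a \<sqinter> compl M b \<noteq> \<bottom>" using le_iff_meet_compl assms by blast
    then obtain x where "x \<in> mt_atoms M" "x \<sqsubseteq> a \<sqinter> compl M b"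
      using atom_below assms by (metis compl_closed meet_closed)
    then have "x \<in> mt_eta M (a \<sqinter> compl M b)" by (simp add: mt_eta_def)
    then show False using sub assms by (auto simp: eta_meet eta_compl)
  qed
qed (use eta_mono assms in blast)

lemma eta_eq_iff: "\<lbrakk>a \<in> carrier M; b \<in> carrier M\<rbrakk> \<Longrightarrow> mt_eta M a = mt_eta M b \<longleftrightarrow> a = b"
  using eta_subset_iff le_antisym by (metis equalityD1 equalityD2)

lemma sup_eta: "a \<in> carrier M \<Longrightarrow> \<Squnion>(mt_eta M a) = a"
proof -
  assume a: "a \<in> carrier M"
  have sub: "mt_eta M a \<subseteq> mt_atoms M" by (auto simp: mt_eta_def)
  then have "\<Squnion>(mt_eta M a) \<in> carrier M" using atoms_carrier by (intro sup_closed) blast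
  then show ?thesis using eta_eq_iff a eta_sup_atoms[OF sub] by blast
qed

text \<open>\<open>mt_box M a\<close> is the largest open below \<open>a\<close>. Since inclusions
  of images come from inequalities, its image is the largest open set inside
  \<open>mt_eta M a\<close>.\<close>

lemma interior_eta:
  assumes a: "a \<in> carrier M"
  shows "at_space M interior_of (mt_eta M a) = mt_eta M (mt_box M a)"
proof (rule interior_of_unique)
  show "mt_eta M (mt_box M a) \<subseteq> mt_eta M a" using a by (simp add: eta_mono box_closed box_le)
  show "openin (at_space M) (mt_eta M (mt_box M a))"
    using open_eta box_open[OF a] by simp
  fix U assume U: "U \<subseteq> mt_eta M a" "openin (at_space M) U"
  then obtain b where b: "b \<in> mt_opens M" "U = mt_eta M b" using openin_at_space by blast
  then have bc: "b \<in> carrier M" using opens_carrier by blast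
  then have "b \<sqsubseteq> a" using U b a eta_subset_iff by blast
  then have "b \<sqsubseteq> mt_box M a" using box_mono[OF bc a] opensD[OF b(1)] by simp
  then show "U \<subseteq> mt_eta M (mt_box M a)" using b bc a by (simp add: eta_mono box_closed)
qed

lemma compactin_eta_iff:
  assumes a: "a \<in> carrier M"
  shows "compactin (at_space M) (mt_eta M a) \<longleftrightarrow> mt_compact M a"
proof
  \<comment> \<open>Covers in the space and covers in the algebra are the same thing, so finite
    subcovers transfer both ways.\<close>
  have le: "mt_eta M a \<subseteq> \<Union>(mt_eta M ` S) \<longleftrightarrow> a \<sqsubseteq> \<Squnion>S" if "S \<subseteq> carrier M" for S
    using eta_subset_iff[OF a sup_closed[OF that]] eta_sup[OF that] by simp
  {
    assume c: "mt_compact M a"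
    show "compactin (at_space M) (mt_eta M a)"
      unfolding compactin_def
    proof (intro conjI allI impI)
      show "mt_eta M a \<subseteq> topspace (at_space M)" by (auto simp: mt_eta_def)
      fix \<U> assume U: "(\<forall>U\<in>\<U>. openin (at_space M) U) \<and> mt_eta M a \<subseteq> \<Union>\<U>"
      let ?S = "{s \<in> mt_opens M. mt_eta M s \<in> \<U>}"
      have S: "?S \<subseteq> mt_opens M" "?S \<subseteq> carrier M" using opens_carrier by blast+
      have "\<U> = mt_eta M ` ?S" using U by (intro opens_at_space_eq_image) simp
      then have "a \<sqsubseteq> \<Squnion>?S" using U le[OF S(2)] by simp
      then obtain T where T: "T \<subseteq> ?S" "finite T" "a \<sqsubseteq> \<Squnion>T"
        using c S(1) unfolding mt_compact_def by metis
      then have "mt_eta M a \<subseteq> \<Union>(mt_eta M ` T)" using le[of T] S(2) by blast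
      moreover have "mt_eta M ` T \<subseteq> \<U>" using T by blast
      ultimately show "\<exists>\<F>. finite \<F> \<and> \<F> \<subseteq> \<U> \<and> mt_eta M a \<subseteq> \<Union>\<F>"
        using T(2) by blast
    qed
  }
  assume c: "compactin (at_space M) (mt_eta M a)"
  show "mt_compact M a"
    unfolding mt_compact_def
  proof (intro conjI a allI impI)
    fix S assume S: "S \<subseteq> mt_opens M" "a \<sqsubseteq> \<Squnion>S"
    then have Sc: "S \<subseteq> carrier M" using opens_carrier by blast
    have "\<forall>U\<in>mt_eta M ` S. openin (at_space M) U" using S open_eta by blast
    moreover have "mt_eta M a \<subseteq> \<Union>(mt_eta M ` S)" using le[OF Sc] S by simp
    ultimately obtain F where F: "finite F" "F \<subseteq> mt_eta M ` S" "mt_eta M a \<subseteq> \<Union>F"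
      using c unfolding compactin_def by meson
    then obtain T where T: "T \<subseteq> S" "finite T" "F = mt_eta M ` T"
      by (meson finite_subset_image)
    then have "a \<sqsubseteq> \<Squnion>T" using le[of T] F Sc by auto
    then show "\<exists>T\<subseteq>S. finite T \<and> a \<sqsubseteq> \<Squnion>T" using T by blast
  qed
qed

lemma saturated_in_eta_iff:
  assumes a: "a \<in> carrier M"
  shows "saturated_in (at_space M) (mt_eta M a) \<longleftrightarrow> mt_saturated M a"
proof
  assume "saturated_in (at_space M) (mt_eta M a)"
  then obtain \<U> where U: "\<forall>U\<in>\<U>. openin (at_space M) U" "mt_eta M a = mt_atoms M \<inter> \<Inter>\<U>"
    by (auto simp: saturated_in_def)
  let ?S = "{s \<in> mt_opens M. mt_eta M s \<in> \<U>}"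
  have S: "?S \<subseteq> carrier M" using opens_carrier by blast
  have "\<U> = mt_eta M ` ?S" using U(1) by (rule opens_at_space_eq_image)
  then have "mt_eta M a = mt_eta M (\<Sqinter>?S)" using U(2) eta_inf[OF S] by simp
  then have "a = \<Sqinter>?S" using eta_eq_iff a S by simp
  moreover have "?S \<subseteq> mt_opens M" by blast
  ultimately show "mt_saturated M a" unfolding mt_saturated_def by metis
next
  assume "mt_saturated M a"
  then obtain S where S: "S \<subseteq> mt_opens M" "a = \<Sqinter>S" by (auto simp: mt_saturated_def)
  then have "mt_eta M a = mt_atoms M \<inter> \<Inter>(mt_eta M ` S)"
    using eta_inf opens_carrier by (metis subset_trans)
  moreover have "\<forall>U\<in>mt_eta M ` S. openin (at_space M) U" using S open_eta by blast
  ultimately show "saturated_in (at_space M) (mt_eta M a)" unfolding saturated_in_def topspace_at_space by blast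
qed

lemma locally_compact_at_space:
  assumes "mt_locally_compact M"
  shows "locally_compact_space (at_space M)"
  unfolding locally_compact_space_def
proof
  fix x assume "x \<in> topspace (at_space M)"
  then have x: "x \<in> mt_atoms M" by simp
  let ?S = "{v \<in> mt_opens M. mt_way_below M v \<top>}"
  have S: "?S \<subseteq> carrier M" using opens_carrier by blast
  have "\<top> = \<Squnion>?S" using assms top_open by (simp add: mt_locally_compact_def)
  then have "x \<sqsubseteq> \<Squnion>?S" using x atoms_carrier top_higher by (metis subsetD)
  then obtain v where v: "v \<in> ?S" "x \<sqsubseteq> v" using atom_le_sup_iff[OF x S] by blast
  then obtain k where k: "mt_compact M k" "v \<sqsubseteq> k" unfolding mt_way_below_def by blast
  have kc: "k \<in> carrier M" using k by (simp add: mt_compact_def)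
  have "openin (at_space M) (mt_eta M v)" using v open_eta by simp
  moreover have "compactin (at_space M) (mt_eta M k)" using k kc compactin_eta_iff by blast
  moreover have "x \<in> mt_eta M v" using x v by (simp add: mt_eta_def)
  moreover have "mt_eta M v \<subseteq> mt_eta M k" using v k kc S by (intro eta_mono) auto
  ultimately show "\<exists>U K. openin (at_space M) U \<and> compactin (at_space M) K \<and> x \<in> U \<and> U \<subseteq> K"
    by blast
qed

end

section \<open>Morphisms\<close>

text \<open>\<open>sup_pres\<close> and \<open>inf_pres\<close> also demand that both sides be
  complete lattices; this discharges that part.\<close>

lemma (in mt_algebra) complete_lattice: "Complete_Lattice.complete_lattice M"
  by (rule complete_lattice_axioms)

locale mt_morphism = M: mt_algebra M + N: mt_algebra N
  for M :: "'a mt" and N :: "'b mt" +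
  fixes f
  assumes hom: "f \<in> mt_hom M N"
begin

lemma closed [simp]: "a \<in> carrier M \<Longrightarrow> f a \<in> carrier N"
  using hom by (auto simp: mt_hom_def)

lemma sup: "S \<subseteq> carrier M \<Longrightarrow> f (\<Squnion>\<^bsub>M\<^esub> S) = \<Squnion>\<^bsub>N\<^esub> (f ` S)"
  using hom by (auto simp: mt_hom_def sup_pres_def)

lemma inf: "S \<subseteq> carrier M \<Longrightarrow> f (\<Sqinter>\<^bsub>M\<^esub> S) = \<Sqinter>\<^bsub>N\<^esub> (f ` S)"
  using hom by (auto simp: mt_hom_def inf_pres_def)

lemma compl: "a \<in> carrier M \<Longrightarrow> f (compl M a) = compl N (f a)"
  using hom by (auto simp: mt_hom_def)

lemma box: "a \<in> carrier M \<Longrightarrow> f (mt_box M a) \<sqsubseteq>\<^bsub>N\<^esub> mt_box N (f a)"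
  using hom by (auto simp: mt_hom_def)

lemma bottom: "f \<bottom>\<^bsub>M\<^esub> = \<bottom>\<^bsub>N\<^esub>"
  using sup[of "{}"] by simp

lemma mono:
  assumes "a \<in> carrier M" "b \<in> carrier M" "a \<sqsubseteq>\<^bsub>M\<^esub> b"
  shows "f a \<sqsubseteq>\<^bsub>N\<^esub> f b"
proof -
  have "a = \<Sqinter>\<^bsub>M\<^esub> {a, b}" using assms M.le_iff_join by (simp add: meet_def)
  then have "f a = \<Sqinter>\<^bsub>N\<^esub> {f a, f b}" using inf[of "{a, b}"] assms by simp
  then show ?thesis using assms N.le_iff_join by (simp add: meet_def)
qed

lemma opens:
  assumes "a \<in> mt_opens M"
  shows "f a \<in> mt_opens N"
proof (rule N.opensI)
  have a: "a \<in> carrier M" using assms M.opens_carrier by blast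
  then show "f a \<in> carrier N" by simp
  show "f a \<sqsubseteq>\<^bsub>N\<^esub> mt_box N (f a)" using box[OF a] M.opensD[OF assms] by simp
qed

lemma left_adj_galois:
  assumes x: "x \<in> mt_atoms N" and a: "a \<in> carrier M"
  shows "left_adj M N f x \<sqsubseteq>\<^bsub>M\<^esub> a \<longleftrightarrow> x \<sqsubseteq>\<^bsub>N\<^esub> f a"
proof -
  let ?A = "{a \<in> carrier M. x \<sqsubseteq>\<^bsub>N\<^esub> f a}"
  have A: "?A \<subseteq> carrier M" by auto
  have xc: "x \<in> carrier N" using x N.atoms_carrier by blast
  have fA: "f ` ?A \<subseteq> carrier N" by auto
  have unit: "x \<sqsubseteq>\<^bsub>N\<^esub> f (\<Sqinter>\<^bsub>M\<^esub> ?A)"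
    unfolding inf[OF A] using xc fA by (intro N.inf_greatest) auto
  show ?thesis unfolding left_adj_def
  proof
    assume "\<Sqinter>\<^bsub>M\<^esub> ?A \<sqsubseteq>\<^bsub>M\<^esub> a"
    then have "f (\<Sqinter>\<^bsub>M\<^esub> ?A) \<sqsubseteq>\<^bsub>N\<^esub> f a" using A a by (intro mono) auto
    then show "x \<sqsubseteq>\<^bsub>N\<^esub> f a"
      using unit xc a N.le_trans[of x "f (\<Sqinter>\<^bsub>M\<^esub> ?A)" "f a"] A by simp
  next
    assume "x \<sqsubseteq>\<^bsub>N\<^esub> f a"
    then show "\<Sqinter>\<^bsub>M\<^esub> ?A \<sqsubseteq>\<^bsub>M\<^esub> a" using a A by (intro M.inf_lower) auto
  qed
qed

lemma left_adj_closed: "left_adj M N f x \<in> carrier M"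
  unfolding left_adj_def by (rule M.inf_closed) auto

text \<open>An element is determined by its upper bounds, so the Galois equivalence characterises
  the left adjoint. Functoriality on composites is proved through it.\<close>

lemma left_adj_eqI:
  assumes "x \<in> mt_atoms N" "p \<in> carrier M"
    and "\<And>a. a \<in> carrier M \<Longrightarrow> p \<sqsubseteq>\<^bsub>M\<^esub> a \<longleftrightarrow> x \<sqsubseteq>\<^bsub>N\<^esub> f a"
  shows "left_adj M N f x = p"
  using assms left_adj_galois[of x] left_adj_closed M.le_antisym M.le_refl by metis

lemma left_adj_atom:
  assumes x: "x \<in> mt_atoms N"
  shows "left_adj M N f x \<in> mt_atoms M"
proof -
  let ?p = "left_adj M N f x"
  have p: "?p \<in> carrier M" by (rule left_adj_closed)
  have xc: "x \<in> carrier N" "x \<noteq> \<bottom>\<^bsub>N\<^esub>" using x by (auto simp: mt_atoms_def)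
  have "\<not> ?p \<sqsubseteq>\<^bsub>M\<^esub> \<bottom>\<^bsub>M\<^esub>"
    using left_adj_galois[OF x] bottom N.le_bottom_iff xc by simp
  then have nz: "?p \<noteq> \<bottom>\<^bsub>M\<^esub>" using p by auto
  have "y = \<bottom>\<^bsub>M\<^esub> \<or> y = ?p" if y: "y \<in> carrier M" "y \<sqsubseteq>\<^bsub>M\<^esub> ?p" for y
  proof (cases "x \<sqsubseteq>\<^bsub>N\<^esub> f y")
    case True
    then have "?p \<sqsubseteq>\<^bsub>M\<^esub> y" using left_adj_galois[OF x] y by blast
    then show ?thesis using y p M.le_antisym by blast
  next
    case False
    then have "x \<sqsubseteq>\<^bsub>N\<^esub> f (compl M y)" using N.atom_le_compl_iff[OF x] y by (simp add: compl)
    then have "?p \<sqsubseteq>\<^bsub>M\<^esub> compl M y" using left_adj_galois[OF x] y by simp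
    then have "y \<sqsubseteq>\<^bsub>M\<^esub> compl M y" using y p M.le_trans[of y ?p "compl M y"] by simp
    then show ?thesis using M.le_compl_self y by blast
  qed
  then show ?thesis using p nz by (simp add: mt_atoms_def)
qed

lemma vimage_eta:
  assumes a: "a \<in> carrier M"
  shows "{x \<in> mt_atoms N. at_map M N f x \<in> mt_eta M a} = mt_eta N (f a)"
  using left_adj_galois[OF _ a] left_adj_atom by (auto simp: at_map_def mt_eta_def)

lemma at_map_funcset: "at_map M N f \<in> mt_atoms N \<rightarrow>\<^sub>E mt_atoms M"
  using left_adj_atom by (auto simp: at_map_def)

lemma continuous_at_map: "continuous_map (at_space N) (at_space M) (at_map M N f)"
  unfolding continuous_map_def
proof (intro conjI allI impI)
  show "at_map M N f \<in> topspace (at_space N) \<rightarrow> topspace (at_space M)"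
    using at_map_funcset by auto
  fix U assume "openin (at_space M) U"
  then obtain a where a: "a \<in> mt_opens M" "U = mt_eta M a" using M.openin_at_space by metis
  then have "a \<in> carrier M" using M.opens_carrier by blast
  then have "{x \<in> topspace (at_space N). at_map M N f x \<in> U} = mt_eta N (f a)"
    unfolding a(2) by (simp add: vimage_eta)
  then show "openin (at_space N) {x \<in> topspace (at_space N). at_map M N f x \<in> U}"
    using opens[OF a(1)] N.open_eta by simp
qed

end

lemma proper_at_map:
  assumes M: "atomic_mt_algebra M" and N: "atomic_mt_algebra N" and f: "f \<in> proper_mt_hom M N"
  shows "at_map M N f \<in> proper_cont_hom (at_space N) (at_space M)"
proof -
  interpret M: atomic_mt_algebra M by fact
  interpret N: atomic_mt_algebra N by fact
  interpret mt_morphism M N f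
    by unfold_locales (use f in \<open>simp add: proper_mt_hom_def\<close>)
  have "compactin (at_space N) {x \<in> topspace (at_space N). at_map M N f x \<in> K}"
    if K: "compactin (at_space M) K" "saturated_in (at_space M) K" for K
  proof -
    have sub: "K \<subseteq> mt_atoms M" using compactin_subset_topspace[OF K(1)] by simp
    \<comment> \<open>Every set of atoms is the image of its join, so \<open>K\<close> becomes an
      element of \<open>mt_KS M\<close> to which properness of \<open>f\<close> applies.\<close>
    let ?a = "\<Squnion>\<^bsub>M\<^esub> K"
    have a: "?a \<in> carrier M" using sub M.atoms_carrier by (intro M.sup_closed) blast
    have eta: "mt_eta M ?a = K" using M.eta_sup_atoms[OF sub] .
    have "?a \<in> mt_KS M"
      using K M.compactin_eta_iff[OF a] M.saturated_in_eta_iff[OF a] unfolding eta mt_KS_def by simp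
    then have "f ?a \<in> mt_KS N" using f by (simp add: proper_mt_hom_def)
    then have "compactin (at_space N) (mt_eta N (f ?a))"
      using N.compactin_eta_iff a by (simp add: mt_KS_def)
    then show ?thesis using vimage_eta[OF a] unfolding eta by simp
  qed
  then show ?thesis
    unfolding proper_cont_hom_def using continuous_at_map at_map_funcset by simp
qed

lemma at_map_ident:
  assumes "mt_algebra M"
  shows "at_map M M (ident (carrier M)) = ident (mt_atoms M)"
proof -
  interpret mt_algebra M by fact
  have "left_adj M M (ident (carrier M)) x = x" if x: "x \<in> mt_atoms M" for x
  proof -
    have xc: "x \<in> carrier M" using x atoms_carrier by blast
    have "{a \<in> carrier M. x \<sqsubseteq>\<^bsub>M\<^esub> ident (carrier M) a} = {a \<in> carrier M. x \<sqsubseteq>\<^bsub>M\<^esub> a}"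
      by (auto simp: ident_def)
    moreover have "\<Sqinter>\<^bsub>M\<^esub> {a \<in> carrier M. x \<sqsubseteq>\<^bsub>M\<^esub> a} = x"
      using xc by (intro le_antisym inf_lower inf_greatest inf_closed) auto
    ultimately show ?thesis unfolding left_adj_def by simp
  qed
  then show ?thesis unfolding at_map_def ident_def by (intro restrict_ext) simp
qed

lemma at_map_compose:
  assumes "mt_morphism M N f" "mt_morphism N P g" "mt_morphism M P (compose (carrier M) g f)"
  shows "at_map M P (compose (carrier M) g f)
    = compose (mt_atoms P) (at_map M N f) (at_map N P g)"
proof -
  interpret f: mt_morphism M N f by fact
  interpret g: mt_morphism N P g by fact
  interpret gf: mt_morphism M P "compose (carrier M) g f" by fact
  have "left_adj M P (compose (carrier M) g f) x = left_adj M N f (left_adj N P g x)"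
    if x: "x \<in> mt_atoms P" for x
    \<comment> \<open>Two Galois equivalences are chained; the one for \<open>f\<close> applies
      because the left adjoint of \<open>g\<close> sends \<open>x\<close> to an atom.\<close>
    using x f.left_adj_galois[OF g.left_adj_atom[OF x]] g.left_adj_galois[OF x] f.left_adj_closed
    by (intro gf.left_adj_eqI) (auto simp: compose_eq)
  then show ?thesis
    using g.left_adj_atom by (auto simp: at_map_def compose_def fun_eq_iff restrict_def)
qed

lemma mt_hom_compose:
  assumes "mt_morphism M N f" "mt_morphism N P g"
  shows "compose (carrier M) g f \<in> mt_hom M P"
proof -
  interpret f: mt_morphism M N f by fact
  interpret g: mt_morphism N P g by fact
  have im: "compose (carrier M) g f ` S = g ` f ` S" if "S \<subseteq> carrier M" for S
    using that by (force simp: compose_def image_iff)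
  have "sup_pres M P (compose (carrier M) g f)"
    unfolding sup_pres_def
  proof (intro conjI f.M.complete_lattice g.N.complete_lattice allI impI)
    fix S assume S: "S \<subseteq> carrier M"
    then have "f ` S \<subseteq> carrier N" by auto
    then show "compose (carrier M) g f (\<Squnion>\<^bsub>M\<^esub> S) = \<Squnion>\<^bsub>P\<^esub> (compose (carrier M) g f ` S)"
      using S f.sup[OF S] g.sup[of "f ` S"] im[OF S] by (simp add: compose_eq)
  qed
  moreover have "inf_pres M P (compose (carrier M) g f)"
    unfolding inf_pres_def
  proof (intro conjI f.M.complete_lattice g.N.complete_lattice allI impI)
    fix S assume S: "S \<subseteq> carrier M"
    then have "f ` S \<subseteq> carrier N" by auto
    then show "compose (carrier M) g f (\<Sqinter>\<^bsub>M\<^esub> S) = \<Sqinter>\<^bsub>P\<^esub> (compose (carrier M) g f ` S)"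
      using S f.inf[OF S] g.inf[of "f ` S"] im[OF S] by (simp add: compose_eq)
  qed
  moreover have "g (f (mt_box M a)) \<sqsubseteq>\<^bsub>P\<^esub> mt_box P (g (f a))" if a: "a \<in> carrier M" for a
  proof -
    \<comment> \<open>The box inequality of \<open>f\<close> is pushed through the monotone
      \<open>g\<close> before that of \<open>g\<close> is applied.\<close>
    have "g (f (mt_box M a)) \<sqsubseteq>\<^bsub>P\<^esub> g (mt_box N (f a))"
      using f.box a by (intro g.mono) (auto simp: f.M.box_closed f.N.box_closed)
    also have "g (mt_box N (f a)) \<sqsubseteq>\<^bsub>P\<^esub> mt_box P (g (f a))" using g.box a by simp
    finally show ?thesis using a by (simp add: f.M.box_closed f.N.box_closed g.N.box_closed)
  qed
  ultimately show ?thesis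
    unfolding mt_hom_def
    by (auto simp: compose_eq f.compl g.compl f.M.box_closed compose_extensional[THEN extensional_arb])
qed

lemma proper_mt_hom_ident:
  assumes "mt_algebra M"
  shows "ident (carrier M) \<in> proper_mt_hom M M"
proof -
  interpret mt_algebra M by fact
  have im: "ident (carrier M) ` S = S" if "S \<subseteq> carrier M" for S
    using that by (force simp: ident_def image_iff)
  have id: "ident (carrier M) a = a" if "a \<in> carrier M" for a using that by (simp add: ident_def)
  have "sup_pres M M (ident (carrier M))" "inf_pres M M (ident (carrier M))"
    unfolding sup_pres_def inf_pres_def using complete_lattice im id by simp_all
  moreover have "ident (carrier M) \<in> carrier M \<rightarrow>\<^sub>E carrier M" by (auto simp: ident_def)
  ultimately show ?thesis
    unfolding proper_mt_hom_def mt_hom_def by (auto simp: id box_closed mt_KS_def mt_compact_def)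
qed

lemma proper_cont_hom_ident: "ident (topspace X) \<in> proper_cont_hom X X"
proof -
  have "continuous_map X X (ident (topspace X))"
    unfolding ident_def by (simp add: continuous_map_eq[OF continuous_map_id])
  moreover have "{x \<in> topspace X. ident (topspace X) x \<in> K} = K" if "compactin X K" for K
    using compactin_subset_topspace[OF that] by (auto simp: ident_def)
  ultimately show ?thesis by (auto simp: proper_cont_hom_def ident_def)
qed

text \<open>Preimages of opens are open and preimages commute with intersections. Properness tests
  only saturated compact sets, so composing proper maps requires that the intermediate preimage be
  saturated again.\<close>

lemma saturated_in_vimage:
  assumes f: "continuous_map X Y f" and K: "saturated_in Y K"
  shows "saturated_in X {x \<in> topspace X. f x \<in> K}"
proof -
  obtain \<U> where U: "\<forall>U\<in>\<U>. openin Y U" "K = topspace Y \<inter> \<Inter>\<U>"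
    using K by (auto simp: saturated_in_def)
  let ?V = "(\<lambda>U. {x \<in> topspace X. f x \<in> U}) ` \<U>"
  have "\<forall>V\<in>?V. openin X V" using U(1) f by (auto simp: continuous_map_def)
  moreover have "{x \<in> topspace X. f x \<in> K} = topspace X \<inter> \<Inter>?V"
    using U(2) f by (auto simp: continuous_map_def)
  ultimately show ?thesis unfolding saturated_in_def by blast
qed

lemma proper_cont_hom_compose:
  assumes f: "f \<in> proper_cont_hom X Y" and g: "g \<in> proper_cont_hom Y Z"
  shows "compose (topspace X) g f \<in> proper_cont_hom X Z"
proof -
  have fc: "continuous_map X Y f" and gc: "continuous_map Y Z g"
    using f g by (auto simp: proper_cont_hom_def)
  have "continuous_map X Z (compose (topspace X) g f)"
    by (rule continuous_map_eq[OF continuous_map_compose[OF fc gc]]) (simp add: compose_def)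
  moreover have "compactin X {x \<in> topspace X. compose (topspace X) g f x \<in> K}"
    if K: "compactin Z K" "saturated_in Z K" for K
  proof -
    let ?L = "{y \<in> topspace Y. g y \<in> K}"
    have "compactin Y ?L" using g K by (auto simp: proper_cont_hom_def)
    moreover have "saturated_in Y ?L" using saturated_in_vimage[OF gc K(2)] .
    ultimately have "compactin X {x \<in> topspace X. f x \<in> ?L}"
      using f unfolding proper_cont_hom_def by blast
    moreover have "{x \<in> topspace X. f x \<in> ?L} = {x \<in> topspace X. compose (topspace X) g f x \<in> K}"
      using fc by (auto simp: compose_def continuous_map_def)
    ultimately show ?thesis by simp
  qed
  ultimately show ?thesis
    using fc gc by (auto simp: proper_cont_hom_def continuous_map_def compose_def)
qed

text \<open>Taking preimages commutes with unions, intersections and complements. Continuity gives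
  the box inequality, since the preimage of an interior is an open part of the preimage; properness
  gives compactness and continuity gives saturation in the condition on
  \<open>mt_KS\<close>.\<close>

lemma pow_map_proper_hom:
  assumes f: "f \<in> proper_cont_hom X Y"
  shows "pow_map X Y f \<in> proper_mt_hom (pow_mt Y) (pow_mt X)"
proof -
  have fc: "continuous_map X Y f" using f by (simp add: proper_cont_hom_def)
  then have fT: "\<And>x. x \<in> topspace X \<Longrightarrow> f x \<in> topspace Y" by (auto simp: continuous_map_def)
  let ?g = "pow_map X Y f"
  have g: "?g B = {x \<in> topspace X. f x \<in> B}" if "B \<subseteq> topspace Y" for B
    using that by (simp add: pow_map_def)
  have im: "?g ` S = (\<lambda>B. {x \<in> topspace X. f x \<in> B}) ` S" if "S \<subseteq> Pow (topspace Y)" for S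
    using that by (intro image_cong) (auto simp: g)
  have "sup_pres (pow_mt Y) (pow_mt X) ?g"
    unfolding sup_pres_def
  proof (intro conjI complete_lattice_pow_mt allI impI)
    fix S assume "S \<subseteq> carrier (pow_mt Y)"
    then have S: "S \<subseteq> Pow (topspace Y)" by simp
    have "?g (\<Union>S) = {x \<in> topspace X. f x \<in> \<Union>S}" by (rule g) (use S in blast)
    also have "\<dots> = \<Union>(?g ` S)" unfolding im[OF S] by blast
    also have "\<dots> = \<Squnion>\<^bsub>pow_mt X\<^esub> (?g ` S)"
      by (rule sup_pow_mt[symmetric]) (auto simp: im[OF S])
    finally show "?g (\<Squnion>\<^bsub>pow_mt Y\<^esub> S) = \<Squnion>\<^bsub>pow_mt X\<^esub> (?g ` S)" using sup_pow_mt[OF S] by simp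
  qed
  moreover have "inf_pres (pow_mt Y) (pow_mt X) ?g"
    unfolding inf_pres_def
  proof (intro conjI complete_lattice_pow_mt allI impI)
    fix S assume "S \<subseteq> carrier (pow_mt Y)"
    then have S: "S \<subseteq> Pow (topspace Y)" by simp
    have "?g (topspace Y \<inter> \<Inter>S) = {x \<in> topspace X. f x \<in> topspace Y \<inter> \<Inter>S}" by (rule g) blast
    \<comment> \<open>For empty \<open>S\<close> this says that the preimage of
      \<open>topspace Y\<close> is \<open>topspace X\<close>, which is \<open>fT\<close>.\<close>
    also have "\<dots> = topspace X \<inter> \<Inter>(?g ` S)" unfolding im[OF S] using fT by blast
    also have "\<dots> = \<Sqinter>\<^bsub>pow_mt X\<^esub> (?g ` S)"
      by (rule inf_pow_mt[symmetric]) (auto simp: im[OF S])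
    finally show "?g (\<Sqinter>\<^bsub>pow_mt Y\<^esub> S) = \<Sqinter>\<^bsub>pow_mt X\<^esub> (?g ` S)" using inf_pow_mt[OF S] by simp
  qed
  moreover have "?g (compl (pow_mt Y) B) = compl (pow_mt X) (?g B)" if "B \<subseteq> topspace Y" for B
  proof -
    have "?g (topspace Y - B) = topspace X - ?g B" using that fT by (auto simp: g)
    moreover have "?g B \<subseteq> topspace X" using that by (auto simp: g)
    ultimately show ?thesis using that by (simp add: compl_pow_mt)
  qed
  moreover have "?g (Y interior_of B) \<subseteq> X interior_of (?g B)" if B: "B \<subseteq> topspace Y" for B
  proof (rule interior_of_maximal)
    show "?g (Y interior_of B) \<subseteq> ?g B"
      using interior_of_subset[of Y B] B by (auto simp: g interior_of_subset_topspace)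
    show "openin X (?g (Y interior_of B))"
      using fc by (simp add: g interior_of_subset_topspace continuous_map_def)
  qed
  moreover have "?g \<in> Pow (topspace Y) \<rightarrow>\<^sub>E Pow (topspace X)" by (auto simp: pow_map_def)
  moreover have "?g K \<in> mt_KS (pow_mt X)" if K: "compactin Y K" "saturated_in Y K" for K
  proof -
    have "?g K = {x \<in> topspace X. f x \<in> K}" using compactin_subset_topspace[OF K(1)] by (rule g)
    then show ?thesis
      using f K saturated_in_vimage[OF fc K(2)] by (simp add: KS_pow_mt proper_cont_hom_def)
  qed
  ultimately show ?thesis
    unfolding proper_mt_hom_def mt_hom_def by (simp add: KS_pow_mt Ball_def)
qed

section \<open>The unit and the counit\<close>

text \<open>The inverse sends a set of atoms to its join. Each algebraic law for the inverse is
  checked after applying the injective map \<open>mt_eta M\<close>.\<close>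

lemma (in atomic_mt_algebra) proper_mt_iso_eta:
  "proper_mt_iso M (pow_mt (at_space M)) (\<lambda>a\<in>carrier M. mt_eta M a)"
proof -
  let ?P = "pow_mt (at_space M)"
  let ?e = "\<lambda>a\<in>carrier M. mt_eta M a"
  let ?g = "\<lambda>A\<in>Pow (mt_atoms M). \<Squnion>A"
  have eP: "mt_eta M a \<subseteq> mt_atoms M" for a by (auto simp: mt_eta_def)
  have gc: "\<Squnion>A \<in> carrier M" if "A \<subseteq> mt_atoms M" for A
    using that atoms_carrier by (intro sup_closed) blast
  have KS: "mt_eta M a \<in> mt_KS ?P \<longleftrightarrow> a \<in> mt_KS M" if "a \<in> carrier M" for a
    using compactin_eta_iff[OF that] saturated_in_eta_iff[OF that]
    unfolding KS_pow_mt by (simp add: mt_KS_def)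
  have KSc: "mt_KS M \<subseteq> carrier M" by (auto simp: mt_KS_def mt_compact_def)
  have e_im: "?e ` S = mt_eta M ` S" if "S \<subseteq> carrier M" for S
    using that by (intro image_cong) auto
  have g_im: "mt_eta M ` ?g ` S = S" if "S \<subseteq> Pow (mt_atoms M)" for S
  proof -
    have "(\<lambda>A. mt_eta M (?g A)) ` S = (\<lambda>A. A) ` S"
      using that by (intro image_cong refl) (use eta_sup_atoms in auto)
    then show ?thesis by (simp only: image_image image_ident)
  qed
  have g_sub: "?g ` S \<subseteq> carrier M" if "S \<subseteq> Pow (mt_atoms M)" for S
    using that gc by auto
  have ge: "?g (mt_eta M a) = a" if "a \<in> carrier M" for a
    using that sup_eta eP by simp
  have "?e \<in> proper_mt_hom M ?P"
  proof -
    have "sup_pres M ?P ?e"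
      unfolding sup_pres_def
    proof (intro conjI complete_lattice_pow_mt complete_lattice allI impI)
      fix S assume S: "S \<subseteq> carrier M"
      have "mt_eta M ` S \<subseteq> Pow (topspace (at_space M))" using eP by auto
      then have "\<Squnion>\<^bsub>?P\<^esub> (mt_eta M ` S) = \<Union>(mt_eta M ` S)" by (rule sup_pow_mt)
      then show "?e (\<Squnion>S) = \<Squnion>\<^bsub>?P\<^esub> (?e ` S)"
        unfolding e_im[OF S] using S by (simp add: eta_sup)
    qed
    moreover have "inf_pres M ?P ?e"
      unfolding inf_pres_def
    proof (intro conjI complete_lattice_pow_mt complete_lattice allI impI)
      fix S assume S: "S \<subseteq> carrier M"
      have "mt_eta M ` S \<subseteq> Pow (topspace (at_space M))" using eP by auto
      then have "\<Sqinter>\<^bsub>?P\<^esub> (mt_eta M ` S) = mt_atoms M \<inter> \<Inter>(mt_eta M ` S)"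
        using inf_pow_mt by (metis topspace_at_space)
      then show "?e (\<Sqinter>S) = \<Sqinter>\<^bsub>?P\<^esub> (?e ` S)"
        unfolding e_im[OF S] using S by (simp add: eta_inf)
    qed
    moreover have "compl ?P (mt_eta M a) = mt_atoms M - mt_eta M a" for a
      using eP by (simp add: compl_pow_mt)
    ultimately show ?thesis
      unfolding proper_mt_hom_def mt_hom_def using eP KS KSc
      by (auto simp: eta_compl interior_eta box_closed subset_iff)
  qed
  moreover have "?g \<in> proper_mt_hom ?P M"
  proof -
    have "sup_pres ?P M ?g"
      unfolding sup_pres_def
    proof (intro conjI complete_lattice_pow_mt complete_lattice allI impI)
      fix S assume "S \<subseteq> carrier ?P"
      then have S: "S \<subseteq> Pow (mt_atoms M)" by simp
      then have US: "\<Union>S \<subseteq> mt_atoms M" by blast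
      \<comment> \<open>Both sides have atom set \<open>\<Union>S\<close>, and injectivity of
        \<open>mt_eta M\<close> identifies the two joins.\<close>
      have "mt_eta M (\<Squnion>(\<Union>S)) = mt_eta M (\<Squnion>(?g ` S))"
        unfolding eta_sup_atoms[OF US] eta_sup[OF g_sub[OF S]] g_im[OF S] ..
      then have "\<Squnion>(\<Union>S) = \<Squnion>(?g ` S)" using eta_eq_iff gc[OF US] g_sub[OF S] by simp
      moreover have "\<Squnion>\<^bsub>?P\<^esub> S = \<Union>S" using S by (intro sup_pow_mt) simp
      ultimately show "?g (\<Squnion>\<^bsub>?P\<^esub> S) = \<Squnion>(?g ` S)" using US by simp
    qed
    moreover have "inf_pres ?P M ?g"
      unfolding inf_pres_def
    proof (intro conjI complete_lattice_pow_mt complete_lattice allI impI)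
      fix S assume "S \<subseteq> carrier ?P"
      then have S: "S \<subseteq> Pow (mt_atoms M)" by simp
      let ?I = "mt_atoms M \<inter> \<Inter>S"
      have I: "?I \<subseteq> mt_atoms M" by blast
      have "mt_eta M (\<Squnion>?I) = mt_eta M (\<Sqinter>(?g ` S))"
        unfolding eta_sup_atoms[OF I] eta_inf[OF g_sub[OF S]] g_im[OF S] ..
      then have "\<Squnion>?I = \<Sqinter>(?g ` S)" using eta_eq_iff gc[OF I] g_sub[OF S] by simp
      moreover have "\<Sqinter>\<^bsub>?P\<^esub> S = ?I" using S inf_pow_mt[of S "at_space M"] by simp
      ultimately show "?g (\<Sqinter>\<^bsub>?P\<^esub> S) = \<Sqinter>(?g ` S)" by simp
    qed
    moreover have "?g (compl ?P A) = compl M (?g A)" if A: "A \<subseteq> mt_atoms M" for A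
    proof -
      have "mt_eta M (\<Squnion>(mt_atoms M - A)) = mt_eta M (compl M (\<Squnion>A))"
        using gc[OF A] A by (simp add: eta_compl eta_sup_atoms)
      then have "\<Squnion>(mt_atoms M - A) = compl M (\<Squnion>A)"
        using eta_eq_iff gc[OF A] gc[of "mt_atoms M - A"] by simp
      then show ?thesis using A by (simp add: compl_pow_mt)
    qed
    moreover have "?g (at_space M interior_of A) \<sqsubseteq> mt_box M (?g A)" if A: "A \<subseteq> mt_atoms M" for A
    proof -
      \<comment> \<open>\<open>mt_eta M\<close> commutes exactly with box and interior. An
        inequality in one direction alone would not make the inverse a morphism.\<close>
      have "at_space M interior_of A = mt_eta M (mt_box M (\<Squnion>A))"
        using interior_eta[OF gc[OF A]] unfolding eta_sup_atoms[OF A] .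
      then have "?g (at_space M interior_of A) = mt_box M (\<Squnion>A)"
        using ge[of "mt_box M (\<Squnion>A)"] gc[OF A] box_closed by simp
      then show ?thesis using A gc[OF A] box_closed by simp
    qed
    moreover have "?g K \<in> mt_KS M" if K: "K \<in> mt_KS ?P" for K
    proof -
      have "K \<subseteq> mt_atoms M" using K compactin_subset_topspace by (force simp: KS_pow_mt)
      then show ?thesis using KS[OF gc] eta_sup_atoms K by simp
    qed
    moreover have "?g \<in> Pow (mt_atoms M) \<rightarrow>\<^sub>E carrier M" using gc by auto
    ultimately show ?thesis
      unfolding proper_mt_hom_def mt_hom_def by (simp add: Ball_def)
  qed
  moreover have "compose (carrier M) ?g ?e = ident (carrier M)"
    unfolding compose_def ident_def using ge by (intro restrict_ext) (simp add: restrict_apply)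
  moreover have "compose (carrier ?P) ?e ?g = ident (carrier ?P)"
    unfolding compose_def ident_def using eta_sup_atoms gc by (intro restrict_ext) simp
  ultimately show ?thesis unfolding proper_mt_iso_def by metis
qed

text \<open>The preimage of \<open>K\<close> under \<open>s\<close> is the image of \<open>K\<close>
  under the continuous inverse \<open>t\<close>, hence compact.\<close>

lemma proper_cont_hom_of_homeomorphic_maps:
  assumes hom: "homeomorphic_maps X Y s t" and ext: "s \<in> extensional (topspace X)"
  shows "s \<in> proper_cont_hom X Y"
proof -
  have s: "continuous_map X Y s" and t: "continuous_map Y X t"
    and ts: "\<And>x. x \<in> topspace X \<Longrightarrow> t (s x) = x" and st: "\<And>y. y \<in> topspace Y \<Longrightarrow> s (t y) = y"
    using hom by (auto simp: homeomorphic_maps_def)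
  have tT: "t y \<in> topspace X" if "y \<in> topspace Y" for y
    using t that by (auto simp: continuous_map_def)
  have "compactin X {x \<in> topspace X. s x \<in> K}" if K: "compactin Y K" for K
  proof -
    have sub: "K \<subseteq> topspace Y" using compactin_subset_topspace[OF K] .
    have "{x \<in> topspace X. s x \<in> K} = t ` K"
    proof (intro equalityI subsetI)
      fix x assume "x \<in> {x \<in> topspace X. s x \<in> K}"
      then show "x \<in> t ` K" using ts[of x] by (metis (mono_tags) imageI mem_Collect_eq)
    qed (use sub tT st in auto)
    then show ?thesis using image_compactin[OF K t] by simp
  qed
  then show ?thesis using s ext by (auto simp: proper_cont_hom_def continuous_map_def PiE_def)
qed

text \<open>The atoms of \<open>pow_mt X\<close> are the singletons, and the opens of its atom space
  are the images of the opens of \<open>X\<close>. The inverse reads off the element with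
  \<open>the_elem\<close>.\<close>

lemma at_space_pow_mt_singleton_iso:
  "proper_cont_iso X (at_space (pow_mt X)) (\<lambda>x\<in>topspace X. {x})"
proof -
  interpret mt_algebra "pow_mt X" by (rule mt_algebra_pow_mt)
  let ?A = "at_space (pow_mt X)"
  let ?s = "\<lambda>x\<in>topspace X. {x}"
  let ?t = "\<lambda>A\<in>topspace ?A. the_elem A"
  have T: "topspace ?A = (\<lambda>x. {x}) ` topspace X" by (simp add: atoms_pow_mt)
  have eta: "mt_eta (pow_mt X) U = (\<lambda>x. {x}) ` U" if "U \<subseteq> topspace X" for U
    using that by (auto simp: mt_eta_def atoms_pow_mt)
  have op: "openin ?A V \<longleftrightarrow> (\<exists>U. openin X U \<and> V = (\<lambda>x. {x}) ` U)" for V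
    unfolding openin_at_space opens_pow_mt using eta openin_subset by (metis mem_Collect_eq)
  have hom: "homeomorphic_maps X ?A ?s ?t"
    unfolding homeomorphic_maps_def
  proof (intro conjI ballI)
    show "continuous_map X ?A ?s"
      unfolding continuous_map_def
    proof (intro conjI allI impI)
      fix V assume "openin ?A V"
      then obtain U where U: "openin X U" "V = (\<lambda>x. {x}) ` U" using op by blast
      then have "{x \<in> topspace X. ?s x \<in> V} = U" using openin_subset[OF U(1)] by auto
      then show "openin X {x \<in> topspace X. ?s x \<in> V}" using U by simp
    qed (unfold T, auto)
    show "continuous_map ?A X ?t"
      unfolding continuous_map_def
    proof (intro conjI allI impI)
      show "?t \<in> topspace ?A \<rightarrow> topspace X" unfolding T by auto
      fix U assume U: "openin X U"
      then have "{A \<in> topspace ?A. ?t A \<in> U} = (\<lambda>x. {x}) ` U"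
        using openin_subset[OF U] unfolding T by auto
      then show "openin ?A {A \<in> topspace ?A. ?t A \<in> U}" using op U by metis
    qed
  qed (unfold T, auto)
  then have "?s \<in> proper_cont_hom X ?A"
    by (rule proper_cont_hom_of_homeomorphic_maps) (rule restrict_extensional)
  moreover have "homeomorphic_maps ?A X ?t ?s" using hom homeomorphic_maps_sym by blast
  then have "?t \<in> proper_cont_hom ?A X"
    by (rule proper_cont_hom_of_homeomorphic_maps) (rule restrict_extensional)
  moreover have "compose (topspace X) ?t ?s = ident (topspace X)"
    unfolding compose_def ident_def by (intro restrict_ext) (simp add: atoms_pow_mt)
  moreover have "compose (topspace ?A) ?s ?t = ident (topspace ?A)"
    unfolding compose_def ident_def by (intro restrict_ext) (auto simp: atoms_pow_mt)
  ultimately show ?thesis unfolding proper_cont_iso_def by metis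
qed

section \<open>Dual equivalences\<close>

lemma pow_map_ident: "pow_map X X (ident (topspace X)) = ident (Pow (topspace X))"
  unfolding pow_map_def ident_def by (intro restrict_ext) auto

lemma pow_map_compose:
  assumes "f \<in> topspace X \<rightarrow> topspace Y"
  shows "pow_map X Z (compose (topspace X) g f)
    = compose (Pow (topspace Z)) (pow_map X Y f) (pow_map Y Z g)"
  using assms unfolding compose_def pow_map_def by (intro restrict_ext) auto

text \<open>The left adjoint of the preimage map is the direct image: the least set whose preimage
  contains \<open>x\<close> is \<open>{f x}\<close>. This is naturality of the singleton map at a
  point.\<close>

lemma at_map_pow_map_singleton:
  assumes f: "f \<in> topspace X \<rightarrow> topspace Y" and x: "x \<in> topspace X"
  shows "at_map (pow_mt Y) (pow_mt X) (pow_map X Y f) {x} = {f x}"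
proof -
  have fx: "f x \<in> topspace Y" using f x by blast
  have "{B \<in> carrier (pow_mt Y). {x} \<sqsubseteq>\<^bsub>pow_mt X\<^esub> pow_map X Y f B} = {B. B \<subseteq> topspace Y \<and> f x \<in> B}"
    using x by (auto simp: pow_map_def)
  moreover have "\<Sqinter>\<^bsub>pow_mt Y\<^esub> {B. B \<subseteq> topspace Y \<and> f x \<in> B}
      = topspace Y \<inter> \<Inter>{B. B \<subseteq> topspace Y \<and> f x \<in> B}"
    by (rule inf_pow_mt) blast
  moreover have "\<dots> = {f x}"
    using fx by (intro equalityI Int_greatest subsetI) auto
  ultimately show ?thesis using x by (simp add: at_map_def left_adj_def atoms_pow_mt)
qed

text \<open>Fixing the morphisms and varying only the class of objects makes inclusion of classes
  the same as being a full subcategory.\<close>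

definition mt_category :: "'a mt set \<Rightarrow> ('a mt, 'a) concrete_cat" where
  "mt_category \<A> = \<lparr>Obj = \<A>, Und = carrier, Hom = proper_mt_hom\<rparr>"

definition space_category :: "'a topology set \<Rightarrow> ('a topology, 'a) concrete_cat" where
  "space_category \<B> = \<lparr>Obj = \<B>, Und = topspace, Hom = proper_cont_hom\<rparr>"

lemma category_simps [simp]:
  "Obj (mt_category \<A>) = \<A>" "Und (mt_category \<A>) = carrier" "Hom (mt_category \<A>) = proper_mt_hom"
  "Obj (space_category \<B>) = \<B>" "Und (space_category \<B>) = topspace"
  "Hom (space_category \<B>) = proper_cont_hom"
  by (simp_all add: mt_category_def space_category_def)

lemma mt_morphismI:
  assumes "mt_algebra M" "mt_algebra N" "f \<in> proper_mt_hom M N"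
  shows "mt_morphism M N f"
  using assms by (simp add: mt_morphism_def mt_morphism_axioms_def proper_mt_hom_def)

lemma proper_mt_hom_compose:
  assumes alg: "mt_algebra M" "mt_algebra N" "mt_algebra P"
    and f: "f \<in> proper_mt_hom M N" and g: "g \<in> proper_mt_hom N P"
  shows "compose (carrier M) g f \<in> proper_mt_hom M P"
proof -
  have "compose (carrier M) g f \<in> mt_hom M P"
    using mt_hom_compose mt_morphismI alg f g by metis
  then show ?thesis
    using f g by (auto simp: proper_mt_hom_def compose_def mt_KS_def mt_compact_def)
qed

lemma concrete_category_mt_category:
  assumes "\<And>M. M \<in> \<A> \<Longrightarrow> mt_algebra M"
  shows "concrete_category (mt_category \<A>)"
  unfolding concrete_category_def category_simps
proof (intro conjI ballI)
  fix M N P f g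
  assume "M \<in> \<A>" "N \<in> \<A>" "P \<in> \<A>" "f \<in> proper_mt_hom M N" "g \<in> proper_mt_hom N P"
  then show "compose (carrier M) g f \<in> proper_mt_hom M P"
    using assms by (intro proper_mt_hom_compose)
next
  fix M N assume "M \<in> \<A>" "N \<in> \<A>"
  show "proper_mt_hom M N \<subseteq> carrier M \<rightarrow>\<^sub>E carrier N" unfolding proper_mt_hom_def mt_hom_def by blast
qed (intro proper_mt_hom_ident assms)

lemma concrete_category_space_category: "concrete_category (space_category \<B>)"
  unfolding concrete_category_def category_simps
proof (intro conjI ballI)
  fix X Y Z f g
  assume "f \<in> proper_cont_hom X Y" "g \<in> proper_cont_hom Y Z"
  then show "compose (topspace X) g f \<in> proper_cont_hom X Z" by (rule proper_cont_hom_compose)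
next
  fix X Y :: "'a topology"
  show "proper_cont_hom X Y \<subseteq> topspace X \<rightarrow>\<^sub>E topspace Y" unfolding proper_cont_hom_def by blast
qed (rule proper_cont_hom_ident)

lemma contravariant_functor_at:
  assumes \<A>: "\<And>M. M \<in> \<A> \<Longrightarrow> atomic_mt_algebra M \<and> at_space M \<in> \<B>"
  shows "contravariant_functor (mt_category \<A>) (space_category \<B>) at_space at_map"
proof -
  have alg: "mt_algebra M" if "M \<in> \<A>" for M
    using \<A>[OF that] by (simp add: atomic_mt_algebra_def)
  have T: "topspace (at_space M) = mt_atoms M" if "M \<in> \<A>" for M
    using mt_algebra.topspace_at_space[OF alg[OF that]] .
  show ?thesis
    unfolding contravariant_functor_def category_simps
  proof (intro conjI ballI)
    show "concrete_category (mt_category \<A>)" using alg by (rule concrete_category_mt_category)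
    show "concrete_category (space_category \<B>)" by (rule concrete_category_space_category)
  next
    fix M assume M: "M \<in> \<A>"
    show "at_map M M (ident (carrier M)) = ident (topspace (at_space M))"
      unfolding T[OF M] by (intro at_map_ident alg M)
  next
    fix M N P f g
    assume M: "M \<in> \<A>" and N: "N \<in> \<A>" and P: "P \<in> \<A>"
      and f: "f \<in> proper_mt_hom M N" and g: "g \<in> proper_mt_hom N P"
    then show "at_map M P (compose (carrier M) g f)
        = compose (topspace (at_space P)) (at_map M N f) (at_map N P g)"
      unfolding T[OF P]
      by (intro at_map_compose mt_morphismI proper_mt_hom_compose alg)
  next
    fix M assume "M \<in> \<A>"
    then show "at_space M \<in> \<B>" using \<A> by blast
  next
    fix M N f assume "M \<in> \<A>" "N \<in> \<A>" "f \<in> proper_mt_hom M N"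
    then show "at_map M N f \<in> proper_cont_hom (at_space N) (at_space M)"
      using \<A> by (intro proper_at_map) blast+
  qed
qed

lemma contravariant_functor_pow:
  assumes "\<And>M. M \<in> \<A> \<Longrightarrow> mt_algebra M" "\<And>X. X \<in> \<B> \<Longrightarrow> pow_mt X \<in> \<A>"
  shows "contravariant_functor (space_category \<B>) (mt_category \<A>) pow_mt pow_map"
  unfolding contravariant_functor_def category_simps
proof (intro conjI ballI)
  show "concrete_category (mt_category \<A>)" using assms(1) by (rule concrete_category_mt_category)
  show "concrete_category (space_category \<B>)" by (rule concrete_category_space_category)
next
  fix X Y Z f g
  assume f: "f \<in> proper_cont_hom X Y"
  then have "f \<in> topspace X \<rightarrow> topspace Y" by (auto simp: proper_cont_hom_def)
  then show "pow_map X Z (compose (topspace X) g f)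
      = compose (carrier (pow_mt Z)) (pow_map X Y f) (pow_map Y Z g)"
    by (simp add: pow_map_compose)
next
  fix X assume "X \<in> \<B>"
  then show "pow_mt X \<in> \<A>" by (rule assms(2))
  show "pow_map X X (ident (topspace X)) = ident (carrier (pow_mt X))" by (simp add: pow_map_ident)
qed (rule pow_map_proper_hom)

text \<open>The hypotheses follow the type change: \<open>at_space\<close> stays over
  \<open>'a\<close>, \<open>pow_mt\<close> leads to the primed class over \<open>'a set\<close>, and
  \<open>at_space\<close> returns to spaces there. Morphisms and natural maps are handled uniformly,
  so a class of objects need only be closed under the two object maps.\<close>

theorem at_pow_dual_equivalenceI:
  fixes \<A> :: "'a mt set" and \<B> :: "'a topology set"
    and \<A>' :: "'a set mt set" and \<B>' :: "'a set topology set"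
  assumes \<A>: "\<And>M. M \<in> \<A> \<Longrightarrow> atomic_mt_algebra M \<and> at_space M \<in> \<B>"
    and \<B>: "\<And>X. X \<in> \<B> \<Longrightarrow> pow_mt X \<in> \<A>'"
    and \<A>': "\<And>M. M \<in> \<A>' \<Longrightarrow> atomic_mt_algebra M \<and> at_space M \<in> \<B>'"
  shows "at_pow_dual_equivalence (mt_category \<A>) (space_category \<B>)
    (mt_category \<A>') (space_category \<B>')"
  unfolding at_pow_dual_equivalence_def
proof (intro conjI)
  show "contravariant_functor (mt_category \<A>) (space_category \<B>) at_space at_map"
    using \<A> by (rule contravariant_functor_at)
  show "contravariant_functor (mt_category \<A>') (space_category \<B>') at_space at_map"
    using \<A>' by (rule contravariant_functor_at)
  show "contravariant_functor (space_category \<B>) (mt_category \<A>') pow_mt pow_map"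
    using \<A>' \<B> by (intro contravariant_functor_pow) (auto simp: atomic_mt_algebra_def)
  show "natural_iso_from_id (mt_category \<A>) proper_mt_iso (\<lambda>M. pow_mt (at_space M))
      (\<lambda>M N f. pow_map (at_space N) (at_space M) (at_map M N f)) (\<lambda>M. \<lambda>a\<in>carrier M. mt_eta M a)"
    unfolding natural_iso_from_id_def category_simps
  proof (intro conjI ballI)
    fix M assume "M \<in> \<A>"
    then show "proper_mt_iso M (pow_mt (at_space M)) (\<lambda>a\<in>carrier M. mt_eta M a)"
      using \<A> atomic_mt_algebra.proper_mt_iso_eta by blast
  next
    fix M N f assume M: "M \<in> \<A>" and N: "N \<in> \<A>" and f: "f \<in> proper_mt_hom M N"
    have "mt_algebra M" "mt_algebra N" using \<A> M N by (auto simp: atomic_mt_algebra_def)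
    then interpret mt_morphism M N f using f by (rule mt_morphismI)
    \<comment> \<open>Naturality of \<open>mt_eta\<close> is the preimage formula
      \<open>vimage_eta\<close>; the inclusion places \<open>mt_eta M a\<close> in the domain of
      \<open>pow_map\<close>.\<close>
    have "mt_eta M a \<subseteq> mt_atoms M" for a by (auto simp: mt_eta_def)
    then show "compose (carrier M) (pow_map (at_space N) (at_space M) (at_map M N f)) (\<lambda>a\<in>carrier M. mt_eta M a)
        = compose (carrier M) (\<lambda>a\<in>carrier N. mt_eta N a) f"
      unfolding compose_def by (intro restrict_ext) (simp add: pow_map_def vimage_eta)
  qed
  show "natural_iso_from_id (space_category \<B>) proper_cont_iso (\<lambda>X. at_space (pow_mt X))
      (\<lambda>X Y f. at_map (pow_mt Y) (pow_mt X) (pow_map X Y f)) (\<lambda>X. \<lambda>x\<in>topspace X. {x})"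
    unfolding natural_iso_from_id_def category_simps
  proof (intro conjI ballI at_space_pow_mt_singleton_iso)
    fix X Y f assume "f \<in> proper_cont_hom X Y"
    then have f: "f \<in> topspace X \<rightarrow> topspace Y" by (auto simp: proper_cont_hom_def)
    then show "compose (topspace X) (at_map (pow_mt Y) (pow_mt X) (pow_map X Y f)) (\<lambda>x\<in>topspace X. {x})
        = compose (topspace X) (\<lambda>x\<in>topspace Y. {x}) f"
      unfolding compose_def
      by (intro restrict_ext) (use at_map_pow_map_singleton[OF f] in auto)
  qed
qed

section \<open>The locally compact Hausdorff and the locally Stone classes\<close>

lemma LCHMT_at_space:
  assumes "M \<in> Obj LCHMT"
  shows "atomic_mt_algebra M \<and> at_space M \<in> Obj LCHaus"
proof -
  have lc: "mt_locally_compact M" and h: "mt_hausdorff M" and "mt_algebra M"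
    using assms by (auto simp: LCHMT_def)
  then interpret mt_algebra M by simp
  interpret atomic_mt_algebra M using atomic t1_of_hausdorff lc h by blast
  show ?thesis
    using locally_compact_at_space[OF lc] Hausdorff_at_space[OF h] atomic_mt_algebra_axioms
    by (simp add: LCHaus_def)
qed

lemma LStoneMT_subset: "Obj LStoneMT \<subseteq> Obj LCHMT"
  by (auto simp: LStoneMT_def LCHMT_def mt_locally_stone_def)

lemma LStone_subset: "Obj LStone \<subseteq> Obj LCHaus"
  by (auto simp: LStone_def LCHaus_def locally_stone_space_def)

lemma LStoneMT_at_space:
  assumes "M \<in> Obj LStoneMT"
  shows "atomic_mt_algebra M \<and> at_space M \<in> Obj LStone"
proof -
  have M: "atomic_mt_algebra M" and "at_space M \<in> Obj LCHaus"
    using assms LStoneMT_subset LCHMT_at_space by auto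
  then have lc: "locally_compact_space (at_space M)" and h: "Hausdorff_space (at_space M)"
    by (auto simp: LCHaus_def)
  have "mt_algebra M" "mt_zero_dimensional M"
    using assms by (auto simp: LStoneMT_def mt_locally_stone_def)
  \<comment> \<open>The \<open>T\<^sub>1\<close> part comes from the Hausdorff property of the atom
    space.\<close>
  then have "zero_dimensional_space (at_space M)"
    using mt_algebra.zero_dimensional_at_space Hausdorff_imp_t1_space[OF h] by blast
  then show ?thesis using M lc h by (simp add: LStone_def locally_stone_space_def)
qed

lemma LCHaus_pow_mt: "X \<in> Obj LCHaus \<Longrightarrow> pow_mt X \<in> Obj LCHMT"
  by (simp add: LCHaus_def LCHMT_def mt_algebra_pow_mt locally_compact_pow_mt hausdorff_pow_mt)

lemma LStone_pow_mt: "X \<in> Obj LStone \<Longrightarrow> pow_mt X \<in> Obj LStoneMT"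
  by (simp add: LStone_def LStoneMT_def locally_stone_space_def mt_locally_stone_def
      mt_algebra_pow_mt locally_compact_pow_mt hausdorff_pow_mt zero_dimensional_pow_mt)

text \<open>Each category is determined by its objects within the parametrised family. The
  right-hand sides contain the left-hand ones, so the equations are meant for rewriting from right
  to left.\<close>

lemma category_eqs:
  "LCHMT = mt_category (Obj LCHMT)" "LStoneMT = mt_category (Obj LStoneMT)"
  "LCHaus = space_category (Obj LCHaus)" "LStone = space_category (Obj LStone)"
  by (simp_all add: LCHMT_def LStoneMT_def LCHaus_def LStone_def mt_category_def space_category_def)

lemma full_subcategory_mt_category:
  assumes "\<A> \<subseteq> \<A>'" "\<And>M. M \<in> \<A>' \<Longrightarrow> mt_algebra M"
  shows "full_subcategory (mt_category \<A>) (mt_category \<A>')"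
  using assms concrete_category_mt_category[of \<A>] concrete_category_mt_category[of \<A>']
  by (auto simp: full_subcategory_def)

lemma full_subcategory_space_category:
  "\<B> \<subseteq> \<B>' \<Longrightarrow> full_subcategory (space_category \<B>) (space_category \<B>')"
  by (simp add: full_subcategory_def concrete_category_space_category)

theorem theorem7p12:
  shows "at_pow_dual_equivalence
           (LCHMT :: ('a mt, 'a) concrete_cat) (LCHaus :: ('a topology, 'a) concrete_cat)
           (LCHMT :: ('a set mt, 'a set) concrete_cat)
           (LCHaus :: ('a set topology, 'a set) concrete_cat)
       \<and> full_subcategory (LStoneMT :: ('a mt, 'a) concrete_cat) LCHMT
       \<and> full_subcategory (LStone :: ('a topology, 'a) concrete_cat) LCHaus
       \<and> at_pow_dual_equivalence
           (LStoneMT :: ('a mt, 'a) concrete_cat) (LStone :: ('a topology, 'a) concrete_cat)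
           (LStoneMT :: ('a set mt, 'a set) concrete_cat)
           (LStone :: ('a set topology, 'a set) concrete_cat)"
proof -
  have "at_pow_dual_equivalence (mt_category (Obj LCHMT :: 'a mt set)) (space_category (Obj LCHaus))
      (mt_category (Obj LCHMT)) (space_category (Obj LCHaus))"
    \<comment> \<open>\<open>LCHMT_at_space\<close> enters twice, once over \<open>'a\<close> and
      once over \<open>'a set\<close>.\<close>
    by (rule at_pow_dual_equivalenceI[OF LCHMT_at_space LCHaus_pow_mt LCHMT_at_space])
  moreover have "at_pow_dual_equivalence (mt_category (Obj LStoneMT :: 'a mt set))
      (space_category (Obj LStone)) (mt_category (Obj LStoneMT)) (space_category (Obj LStone))"
    by (rule at_pow_dual_equivalenceI[OF LStoneMT_at_space LStone_pow_mt LStoneMT_at_space])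
  moreover have "full_subcategory (mt_category (Obj LStoneMT :: 'a mt set)) (mt_category (Obj LCHMT))"
    using LStoneMT_subset by (intro full_subcategory_mt_category) (auto simp: LCHMT_def)
  moreover have "full_subcategory (space_category (Obj LStone :: 'a topology set)) (space_category (Obj LCHaus))"
    using LStone_subset by (rule full_subcategory_space_category)
  ultimately show ?thesis by (simp only: category_eqs[symmetric])
qed

end
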